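(* Let $\kappa$ be an infinite cardinal. Let $\mathbb{B}$ be a complete Boolean algebra such that $\mathbb{B}$ is $(\omega,2)$-distributive and $1 \Vdash_{\mathbb{B}} (\check{\kappa} < \mathfrak{t})$. Then $\mathbb{B}$ is $(\kappa,2)$-distributive.
   Context: For ordinals $\mu,\nu$, a complete Boolean algebra $\mathbb{B}$ is $(\mu,\nu)$-distributive iff for every family $\langle u_{\alpha,\beta} \in \mathbb{B} : \alpha<\mu, \beta<\nu\rangle$, $\prod_{\alpha<\mu}\sum_{\beta<\nu} u_{\alpha,\beta} = \sum_{f:\mu\to\nu}\prod_{\alpha<\mu} u_{\alpha,f(\alpha)}$; equivalently, $1$ forces that every function from $\check\mu$ to $\check\nu$ lies in the ground model. The tower number $\mathfrak{t}$ is the smallest length $\delta$ of a sequence $\langle S_\alpha \in [\omega]^\omega : \alpha<\delta\rangle$ such that $S_\alpha \supseteq^* S_\beta$ for all $\alpha<\beta<\delta$ but there is no $S\in[\omega]^\omega$ with $S_\alpha\supseteq^* S$ for all $\alpha<\delta$; here $S_1\subseteq^* S_2$ means $S_1\setminus S_2$ is finite. In the forcing statement, $\mathfrak{t}$ is computed in the forcing extension. *)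

theory Defs
  imports Main "HOL-Library.FuncSet"
begin

unbundle lattice_syntax

(* The library class complete_boolean_algebra is not used: it extends complete_distrib_lattice, so
   its members are completely distributive, which is far more than completeness. *)
class complete_ba = complete_lattice + boolean_algebra

(* Only the underlying sets M and N of the two ordinals matter. *)
definition distributive :: "'b::complete_ba itself \<Rightarrow> 'm set \<Rightarrow> 'n set \<Rightarrow> bool" where
  "distributive TYPE('b) M N \<longleftrightarrow>
     (\<forall>u :: 'm \<Rightarrow> 'n \<Rightarrow> 'b.
        (\<Sqinter>a\<in>M. \<Squnion>c\<in>N. u a c) = (\<Squnion>f\<in>M \<rightarrow>\<^sub>E N. \<Sqinter>a\<in>M. u a (f a)))"


text \<open>
  The Boolean-valued universe. A name is a well-founded tree: a set of pairs (name, Boolean value),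
  indexed by a subset of the type \<open>'i\<close>. As HOL has no type of all sets, the width of names is
  bounded by the cardinality of \<open>'i\<close>. That type is arbitrary: the cardinal \<open>\<kappa>\<close> of the
  theorem is a well-order on a subset of \<open>'i\<close>, which may be much larger than \<open>\<kappa>\<close>.
\<close>

datatype ('i, 'b) bname = BName "'i \<Rightarrow> (('i, 'b) bname \<times> 'b) option"

primrec elts :: "('i, 'b) bname \<Rightarrow> (('i, 'b) bname \<times> 'b) set" where
  "elts (BName f) = ran f"

definition elt_rel :: "(('i, 'b) bname \<times> ('i, 'b) bname) set" where
  "elt_rel = {(s, x). \<exists>c. (s, c) \<in> elts x}"

lemma wf_elt_rel: "wf (elt_rel :: (('i, 'b) bname \<times> ('i, 'b) bname) set)"
proof (rule wfUNIVI)
  fix P :: "('i, 'b) bname \<Rightarrow> bool" and x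
  assume step: "\<forall>x. (\<forall>y. (y, x) \<in> elt_rel \<longrightarrow> P y) \<longrightarrow> P x"
  show "P x"
  proof (induction x)
    case (BName f)
    have "P y" if "(y, BName f) \<in> elt_rel" for y
    proof -
      from that obtain c i where "f i = Some (y, c)"
        by (auto simp: elt_rel_def ran_def)
      then show ?thesis
        by (intro BName) (auto intro!: rangeI image_eqI[where x = i] simp: prod_set_defs)
    qed
    then show ?case using step by blast
  qed
qed

definition bimp :: "'b::complete_ba \<Rightarrow> 'b \<Rightarrow> 'b"  (infixr "\<rightarrow>\<^sub>B" 60) where
  "a \<rightarrow>\<^sub>B b = - a \<squnion> b"

definition biff :: "'b::complete_ba \<Rightarrow> 'b \<Rightarrow> 'b"  (infix "\<leftrightarrow>\<^sub>B" 58) where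
  "a \<leftrightarrow>\<^sub>B b = (a \<rightarrow>\<^sub>B b) \<sqinter> (b \<rightarrow>\<^sub>B a)"

(* The usual recursion: x = y iff every element of x is in y and conversely, with the Boolean value
   of membership (bmem below) unfolded. *)
function beq :: "('i, 'b::complete_ba) bname \<Rightarrow> ('i, 'b) bname \<Rightarrow> 'b"  (infix "=\<^sub>B" 75) where
  "x =\<^sub>B y =
     (\<Sqinter>p\<in>elts x. snd p \<rightarrow>\<^sub>B (\<Squnion>q\<in>elts y. (fst p =\<^sub>B fst q) \<sqinter> snd q)) \<sqinter>
     (\<Sqinter>q\<in>elts y. snd q \<rightarrow>\<^sub>B (\<Squnion>p\<in>elts x. (fst p =\<^sub>B fst q) \<sqinter> snd p))"
  by pat_completeness auto
termination
  by (relation "inv_image elt_rel fst")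
     (use wf_elt_rel in \<open>blast, auto simp: elt_rel_def\<close>)

declare beq.simps [simp del]

definition bmem :: "('i, 'b::complete_ba) bname \<Rightarrow> ('i, 'b) bname \<Rightarrow> 'b"  (infix "\<in>\<^sub>B" 75) where
  "x \<in>\<^sub>B y = (\<Squnion>q\<in>elts y. (x =\<^sub>B fst q) \<sqinter> snd q)"


text \<open>
  Formulas of set theory are given by their Boolean values: the connectives are the Boolean
  operations, and the quantifiers are infima and suprema over all names.
\<close>

definition bsubset :: "('i, 'b::complete_ba) bname \<Rightarrow> ('i, 'b) bname \<Rightarrow> 'b"  (infix "\<subseteq>\<^sub>B" 75) where
  "x \<subseteq>\<^sub>B y = (\<Sqinter>z. z \<in>\<^sub>B x \<rightarrow>\<^sub>B z \<in>\<^sub>B y)"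

definition is_empty :: "('i, 'b::complete_ba) bname \<Rightarrow> 'b" where
  "is_empty x = (\<Sqinter>z. - (z \<in>\<^sub>B x))"

definition is_suc :: "('i, 'b::complete_ba) bname \<Rightarrow> ('i, 'b) bname \<Rightarrow> 'b" where
  "is_suc y x = (\<Sqinter>z. z \<in>\<^sub>B y \<leftrightarrow>\<^sub>B z \<in>\<^sub>B x \<squnion> z =\<^sub>B x)"

definition is_inductive :: "('i, 'b::complete_ba) bname \<Rightarrow> 'b" where
  "is_inductive v =
     (\<Squnion>e. is_empty e \<sqinter> e \<in>\<^sub>B v) \<sqinter>
     (\<Sqinter>x. x \<in>\<^sub>B v \<rightarrow>\<^sub>B (\<Squnion>y. is_suc y x \<sqinter> y \<in>\<^sub>B v))"

definition is_omega :: "('i, 'b::complete_ba) bname \<Rightarrow> 'b" where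
  "is_omega w = is_inductive w \<sqinter> (\<Sqinter>v. is_inductive v \<rightarrow>\<^sub>B w \<subseteq>\<^sub>B v)"

definition is_transitive :: "('i, 'b::complete_ba) bname \<Rightarrow> 'b" where
  "is_transitive x = (\<Sqinter>y. y \<in>\<^sub>B x \<rightarrow>\<^sub>B y \<subseteq>\<^sub>B x)"

definition is_ordinal :: "('i, 'b::complete_ba) bname \<Rightarrow> 'b" where
  "is_ordinal x = is_transitive x \<sqinter> (\<Sqinter>y. y \<in>\<^sub>B x \<rightarrow>\<^sub>B is_transitive y)"

definition is_upair :: "('i, 'b::complete_ba) bname \<Rightarrow> ('i, 'b) bname \<Rightarrow> ('i, 'b) bname \<Rightarrow> 'b" where
  "is_upair p x y = (\<Sqinter>z. z \<in>\<^sub>B p \<leftrightarrow>\<^sub>B z =\<^sub>B x \<squnion> z =\<^sub>B y)"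

(* p is the Kuratowski pair of x and y *)
definition is_pair :: "('i, 'b::complete_ba) bname \<Rightarrow> ('i, 'b) bname \<Rightarrow> ('i, 'b) bname \<Rightarrow> 'b" where
  "is_pair p x y = (\<Squnion>r. \<Squnion>s. is_upair r x x \<sqinter> is_upair s x y \<sqinter> is_upair p r s)"

(* the pair of x and y belongs to F *)
definition maps_to :: "('i, 'b::complete_ba) bname \<Rightarrow> ('i, 'b) bname \<Rightarrow> ('i, 'b) bname \<Rightarrow> 'b" where
  "maps_to F x y = (\<Squnion>p. is_pair p x y \<sqinter> p \<in>\<^sub>B F)"

(* F is a function with domain d *)
definition is_function :: "('i, 'b::complete_ba) bname \<Rightarrow> ('i, 'b) bname \<Rightarrow> 'b" where
  "is_function F d =
     (\<Sqinter>p. p \<in>\<^sub>B F \<rightarrow>\<^sub>B (\<Squnion>x. \<Squnion>y. x \<in>\<^sub>B d \<sqinter> is_pair p x y)) \<sqinter>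
     (\<Sqinter>x. x \<in>\<^sub>B d \<rightarrow>\<^sub>B (\<Squnion>y. maps_to F x y)) \<sqinter>
     (\<Sqinter>x. \<Sqinter>y. \<Sqinter>z. maps_to F x y \<sqinter> maps_to F x z \<rightarrow>\<^sub>B y =\<^sub>B z)"

definition is_bijection ::
    "('i, 'b::complete_ba) bname \<Rightarrow> ('i, 'b) bname \<Rightarrow> ('i, 'b) bname \<Rightarrow> 'b" where
  "is_bijection F d X =
     is_function F d \<sqinter>
     (\<Sqinter>x. \<Sqinter>y. \<Sqinter>z. maps_to F x z \<sqinter> maps_to F y z \<rightarrow>\<^sub>B x =\<^sub>B y) \<sqinter>
     (\<Sqinter>z. z \<in>\<^sub>B X \<leftrightarrow>\<^sub>B (\<Squnion>x. maps_to F x z))"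

text \<open>In the following definitions \<open>w\<close> stands for \<open>\<omega>\<close> of the Boolean-valued universe.\<close>

definition is_finite :: "('i, 'b::complete_ba) bname \<Rightarrow> ('i, 'b) bname \<Rightarrow> 'b" where
  "is_finite w X = (\<Squnion>n. \<Squnion>F. n \<in>\<^sub>B w \<sqinter> is_bijection F n X)"

definition is_inf_subset :: "('i, 'b::complete_ba) bname \<Rightarrow> ('i, 'b) bname \<Rightarrow> 'b" where
  "is_inf_subset w S = S \<subseteq>\<^sub>B w \<sqinter> - is_finite w S"

definition almost_subset ::
    "('i, 'b::complete_ba) bname \<Rightarrow> ('i, 'b) bname \<Rightarrow> ('i, 'b) bname \<Rightarrow> 'b" where
  "almost_subset w S T =
     (\<Squnion>D. (\<Sqinter>z. z \<in>\<^sub>B D \<leftrightarrow>\<^sub>B z \<in>\<^sub>B S \<sqinter> - (z \<in>\<^sub>B T)) \<sqinter> is_finite w D)"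

(* F is an almost decreasing sequence of length d in the infinite subsets of \<omega>, without an
   infinite pseudo-intersection *)
definition is_tower ::
    "('i, 'b::complete_ba) bname \<Rightarrow> ('i, 'b) bname \<Rightarrow> ('i, 'b) bname \<Rightarrow> 'b" where
  "is_tower w d F =
     is_function F d \<sqinter>
     (\<Sqinter>x. \<Sqinter>S. maps_to F x S \<rightarrow>\<^sub>B is_inf_subset w S) \<sqinter>
     (\<Sqinter>x. \<Sqinter>y. \<Sqinter>S. \<Sqinter>T. x \<in>\<^sub>B y \<sqinter> y \<in>\<^sub>B d \<sqinter> maps_to F x S \<sqinter> maps_to F y T
        \<rightarrow>\<^sub>B almost_subset w T S) \<sqinter>
     - (\<Squnion>S. is_inf_subset w S \<sqinter> (\<Sqinter>x. \<Sqinter>T. maps_to F x T \<rightarrow>\<^sub>B almost_subset w S T))"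

definition is_tower_number :: "('i, 'b::complete_ba) bname \<Rightarrow> ('i, 'b) bname \<Rightarrow> 'b" where
  "is_tower_number w t =
     is_ordinal t \<sqinter> (\<Squnion>F. is_tower w t F) \<sqinter>
     (\<Sqinter>d. d \<in>\<^sub>B t \<rightarrow>\<^sub>B - (\<Squnion>F. is_tower w d F))"


text \<open>
  Check names of the von Neumann ordinals below, and equal to, the order type of a well-order \<open>r\<close>.
  The recursion equation of the first one is
  \<open>check_below r a = BName (\<lambda>b. if b \<in> underS r a then Some (check_below r b, \<top>) else None)\<close>.
\<close>

definition check_below :: "'i rel \<Rightarrow> 'i \<Rightarrow> ('i, 'b::complete_ba) bname" where
  "check_below r =
     wfrec (r - Id) (\<lambda>g a. BName (\<lambda>b. if b \<in> underS r a then Some (g b, \<top>) else None))"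

lemma check_below:
  assumes "Well_order r"
  shows "check_below r a = BName (\<lambda>b. if b \<in> underS r a then Some (check_below r b, \<top>) else None)"
proof -
  have "wf (r - Id)"
    using assms by (simp add: well_order_on_def)
  then show ?thesis
    unfolding check_below_def
    by (subst wfrec, assumption) (auto simp: cut_apply underS_def fun_eq_iff)
qed

definition check :: "'i rel \<Rightarrow> ('i, 'b::complete_ba) bname" where
  "check r = BName (\<lambda>a. if a \<in> Field r then Some (check_below r a, \<top>) else None)"

(* Boolean value of "the ordinal r lies below the tower number". The tower number and \<omega> enter
   through their defining formulas, interpreted in the Boolean-valued universe. *)
definition less_tower_number :: "'i rel \<Rightarrow> 'b::complete_ba" where
  "less_tower_number r =
     (\<Sqinter>w :: ('i, 'b) bname. \<Sqinter>t. is_omega w \<sqinter> is_tower_number w t \<rightarrow>\<^sub>B check r \<in>\<^sub>B t)"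

(* 1 forces the statement with Boolean value b *)
definition forced :: "'b::complete_ba \<Rightarrow> bool" where
  "forced b \<longleftrightarrow> b = \<top>"

end

theory Submission
  imports Defs "HOL-Library.Infinite_Set"
begin

text \<open>
  Suppose that \<open>f : \<kappa> \<rightarrow> 2\<close> lies in the extension and that for every \<open>a < \<kappa>\<close> its restriction to the ordinals up
  to \<open>a\<close> lies in the ground model. In the ground model there is a tree of infinite sets \<open>T a g\<close> of natural numbers, for
  \<open>a < \<kappa>\<close> and \<open>g\<close> from the ordinals up to \<open>a\<close> to \<open>2\<close>, which decreases modulo finite sets along every branch
  and is almost disjoint across different branches. In the extension \<open>f\<close> selects a branch, hence an almost
  decreasing sequence of length \<open>\<kappa>\<close>. As \<open>\<kappa>\<close> is below the tower number there, the sequence has an infinite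
  pseudo-intersection \<open>X\<close>, and \<open>X\<close> is in the ground model because no new sets of natural numbers are added.
  But \<open>f\<close> can be read off from \<open>X\<close>: as \<open>T\<close> is almost disjoint across branches, \<open>f a\<close> is the value \<open>g a\<close> of any
  \<open>g\<close> with \<open>T a g\<close> almost containing \<open>X\<close>. So \<open>f\<close> is in the ground model. By induction along \<open>\<kappa>\<close> this
  gives distributivity at every initial segment.

  The argument is carried out with Boolean values. A name of a function \<open>M \<rightarrow> 2\<close> is a family \<open>x\<close> of elements
  of the algebra, and \<open>cell x g M\<close> is the value of the statement that this function is \<open>g\<close>. Then
  \<open>(M, 2)\<close>-distributivity says that the cells have supremum \<open>\<top>\<close> (\<open>distributive_iff_cells\<close>), and the induction step
  above is \<open>SUP_cell_step\<close>, which uses the tree from \<open>tree_levels\<close> and \<open>tree_almost_disjoint\<close>.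

  The forcing hypothesis enters only through \<open>pseudo_intersection\<close>, a statement about families \<open>s a n\<close> of
  Boolean values that does not mention names. It is used twice: for the sequence selected by \<open>f\<close>, and for
  sequences of sets in the ground model, where it lets the construction of the tree pass through limit levels.
  Its source is \<open>no_tower\<close>: no ordinal up to \<open>\<kappa>\<close> is the length of a tower with nonzero Boolean value. Otherwise,
  at the least such length, that value forces this length to be the tower number, whence it forces \<open>\<kappa>\<close> to belong
  to an ordinal that is at most \<open>\<kappa>\<close>. This argument covers in particular the case in which no
  name stands for the tower number.

  What remains is to evaluate the formula for towers at a concrete name. This needs explicit names for natural
  numbers, pairs and graphs, and the fact that a name of a subset of \<open>\<omega>\<close> is finite exactly to the extent that it
  is bounded (\<open>is_finite_le_bounded\<close>, \<open>le_is_finiteI\<close>).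
\<close>

section \<open>Reasoning with Boolean values\<close>

text \<open>
  An inequality \<open>p \<le> \<phi>\<close> is read as \<open>p\<close> forces \<open>\<phi>\<close>. The rules of this section are natural deduction for this relation.
  Hypotheses are inequalities with a common left-hand side, and a rule that discharges a hypothesis passes to an
  arbitrary stronger condition \<open>q \<le> p\<close> instead of forming a meet.
\<close>

lemma inf_le_iff_le_bimp: "p \<sqinter> a \<le> b \<longleftrightarrow> p \<le> a \<rightarrow>\<^sub>B b"
  for p :: "'b::complete_ba"
  unfolding bimp_def by (metis inf.commute shunt1)

text \<open>
  Meets distribute over arbitrary joins because \<open>a \<sqinter> _\<close> is left adjoint to \<open>a \<rightarrow>\<^sub>B _\<close>.
\<close>

lemma inf_SUP_distrib: "a \<sqinter> (\<Squnion>i\<in>I. f i) = (\<Squnion>i\<in>I. a \<sqinter> f i)"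
  for a :: "'b::complete_ba"
proof (rule antisym)
  have "(\<Squnion>i\<in>I. f i) \<le> a \<rightarrow>\<^sub>B (\<Squnion>i\<in>I. a \<sqinter> f i)"
    by (rule SUP_least, simp only: inf_le_iff_le_bimp[symmetric] inf.commute[of _ a], rule SUP_upper)
  then show "a \<sqinter> (\<Squnion>i\<in>I. f i) \<le> (\<Squnion>i\<in>I. a \<sqinter> f i)"
    by (simp only: inf_le_iff_le_bimp[symmetric] inf.commute[of a])
qed (auto intro!: SUP_least intro: le_infI2 SUP_upper)

lemma le_bimpI:
  "(\<And>q. q \<le> p \<Longrightarrow> q \<le> a \<Longrightarrow> q \<le> b) \<Longrightarrow> p \<le> a \<rightarrow>\<^sub>B b"
  for p :: "'b::complete_ba"
  by (simp add: inf_le_iff_le_bimp[symmetric])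

lemma le_bimpD: "p \<le> a \<rightarrow>\<^sub>B b \<Longrightarrow> p \<le> a \<Longrightarrow> p \<le> b"
  for p :: "'b::complete_ba"
  by (metis inf.absorb_iff1 inf_le_iff_le_bimp)

lemma le_biffI:
  "(\<And>q. q \<le> p \<Longrightarrow> q \<le> a \<Longrightarrow> q \<le> b) \<Longrightarrow> (\<And>q. q \<le> p \<Longrightarrow> q \<le> b \<Longrightarrow> q \<le> a) \<Longrightarrow> p \<le> a \<leftrightarrow>\<^sub>B b"
  for p :: "'b::complete_ba"
  by (simp add: biff_def le_bimpI)

lemma le_biffD1: "p \<le> a \<leftrightarrow>\<^sub>B b \<Longrightarrow> p \<le> a \<Longrightarrow> p \<le> b"
  and le_biffD2: "p \<le> a \<leftrightarrow>\<^sub>B b \<Longrightarrow> p \<le> b \<Longrightarrow> p \<le> a"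
  for p :: "'b::complete_ba"
  by (auto simp: biff_def dest: le_bimpD)

lemma le_SUPI: "i \<in> I \<Longrightarrow> p \<le> f i \<Longrightarrow> p \<le> (\<Squnion>i\<in>I. f i)"
  for p :: "'b::complete_ba"
  by (rule SUP_upper2)

lemma le_SUPE:
  fixes p :: "'b::complete_ba"
  assumes "p \<le> (\<Squnion>i\<in>I. f i)"
    and "\<And>i q. i \<in> I \<Longrightarrow> q \<le> p \<Longrightarrow> q \<le> f i \<Longrightarrow> q \<le> c"
  shows "p \<le> c"
proof -
  have "p = p \<sqinter> (\<Squnion>i\<in>I. f i)"
    using assms(1) by (simp add: inf.absorb1)
  also have "\<dots> \<le> c"
    unfolding inf_SUP_distrib by (rule SUP_least) (simp add: assms(2))
  finally show ?thesis .
qed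

lemma le_supE:
  fixes p :: "'b::complete_ba"
  assumes "p \<le> a \<squnion> b"
    and "\<And>q. q \<le> p \<Longrightarrow> q \<le> a \<Longrightarrow> q \<le> c" "\<And>q. q \<le> p \<Longrightarrow> q \<le> b \<Longrightarrow> q \<le> c"
  shows "p \<le> c"
proof -
  have "p = p \<sqinter> (a \<squnion> b)"
    using assms(1) by (simp add: inf.absorb1)
  also have "\<dots> \<le> c"
    unfolding inf_sup_distrib1 by (simp add: assms)
  finally show ?thesis .
qed

lemma le_uminusI: "(\<And>q. q \<le> p \<Longrightarrow> q \<le> a \<Longrightarrow> q \<le> \<bottom>) \<Longrightarrow> p \<le> - a"
  for p :: "'b::complete_ba"
  using le_bimpI[of p a \<bottom>] by (simp add: bimp_def)

lemma le_uminusD: "p \<le> - a \<Longrightarrow> p \<le> a \<Longrightarrow> p \<le> c"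
  for p :: "'b::complete_ba"
  by (metis bimp_def le_bimpD le_supI1)

lemma le_by_cases:
  fixes p :: "'b::complete_ba"
  assumes "\<And>q. q \<le> p \<Longrightarrow> q \<le> a \<Longrightarrow> q \<le> c" "\<And>q. q \<le> p \<Longrightarrow> q \<le> - a \<Longrightarrow> q \<le> c"
  shows "p \<le> c"
  by (rule le_supE[of p a "- a"]) (simp_all add: assms)

lemma le_INFD: "p \<le> (\<Sqinter>i\<in>I. f i) \<Longrightarrow> i \<in> I \<Longrightarrow> p \<le> f i"
  for p :: "'b::complete_ba"
  by (simp add: le_INF_iff)

section \<open>Functions into two values, described by cells\<close>

definition lit :: "'b::complete_ba \<Rightarrow> bool \<Rightarrow> 'b" where
  "lit x i = (if i then x else - x)"

text \<open>
  With \<open>x a\<close> read as the value of \<open>f a = 1\<close> for a function \<open>f\<close> in the extension, this is the value of the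
  statement that \<open>f\<close> and \<open>g\<close> agree on \<open>M\<close>.
\<close>

definition cell :: "('a \<Rightarrow> 'b::complete_ba) \<Rightarrow> ('a \<Rightarrow> bool) \<Rightarrow> 'a set \<Rightarrow> 'b" where
  "cell x g M = (\<Sqinter>a\<in>M. lit (x a) (g a))"

lemma le_cellD: "p \<le> cell x g M \<Longrightarrow> a \<in> M \<Longrightarrow> p \<le> lit (x a) (g a)"
  unfolding cell_def by (rule le_INFD)

lemma cell_cong: "(\<And>a. a \<in> M \<Longrightarrow> g a = g' a) \<Longrightarrow> cell x g M = cell x g' M"
  unfolding cell_def by (rule INF_cong) auto

lemma cell_mono: "N \<subseteq> M \<Longrightarrow> cell x g M \<le> cell x g N"
  unfolding cell_def by (rule INF_superset_mono) auto

text \<open>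
  Every cell over \<open>M\<close> is split in two by \<open>x a\<close>.
\<close>

lemma SUP_cell_insert:
  assumes "(\<Squnion>g. cell x g M) = \<top>"
  shows "(\<Squnion>g. cell x g (insert a M)) = \<top>"
proof (cases "a \<in> M")
  case False
  have "\<top> \<le> (\<Squnion>g. cell x g M)"
    by (simp add: assms)
  then have "\<top> \<le> (\<Squnion>g. cell x g (insert a M))"
  proof (rule le_SUPE)
    fix g q assume q: "q \<le> cell x g M"
    have *: "r \<le> (\<Squnion>g. cell x g (insert a M))" if "r \<le> q" "r \<le> lit (x a) i" for r i
    proof (rule le_SUPI[of "g(a := i)"])
      have "cell x g M = cell x (g(a := i)) M"
        using False by (intro cell_cong) auto
      then show "r \<le> cell x (g(a := i)) (insert a M)"
        using that q unfolding cell_def by (auto simp: le_INF_iff intro: order_trans)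
    qed simp
    show "q \<le> (\<Squnion>g. cell x g (insert a M))"
      by (rule le_by_cases[of q "x a"]; rule *[of _ True] *[of _ False]) (auto simp: lit_def)
  qed
  then show ?thesis by (simp add: top.extremum_unique)
qed (simp add: insert_absorb assms)

lemma SUP_cell_finite: "finite M \<Longrightarrow> (\<Squnion>g. cell x g M) = \<top>"
  by (induction M rule: finite_induct) (simp add: cell_def, rule SUP_cell_insert)

text \<open>
  The identity for a general \<open>u\<close> follows from the case in which \<open>u a 0\<close> is the complement of \<open>u a 1\<close>: below
  \<open>\<Sqinter>a. u a 0 \<squnion> u a 1\<close>, the complement of \<open>u a 1\<close> is contained in \<open>u a 0\<close>.
\<close>

lemma distributive_iff_cells:
  "distributive TYPE('b::complete_ba) M {..<2::nat} \<longleftrightarrow> (\<forall>x :: 'm \<Rightarrow> 'b. (\<Squnion>g. cell x g M) = \<top>)"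
proof
  assume d: "distributive TYPE('b) M {..<2::nat}"
  show "\<forall>x :: 'm \<Rightarrow> 'b. (\<Squnion>g. cell x g M) = \<top>"
  proof
    fix x :: "'m \<Rightarrow> 'b"
    define u where "u a c = lit (x a) (c = 1)" for a and c :: nat
    have "(\<Squnion>c\<in>{..<2}. u a c) = \<top>" for a
      by (simp add: u_def lit_def numeral_2_eq_2 lessThan_Suc)
    then have "\<top> = (\<Squnion>f\<in>M \<rightarrow>\<^sub>E {..<2}. \<Sqinter>a\<in>M. u a (f a))"
      using d[unfolded distributive_def, rule_format, of u] by simp
    also have "\<dots> \<le> (\<Squnion>g. cell x g M)"
    proof (rule SUP_least)
      fix f
      show "(\<Sqinter>a\<in>M. u a (f a)) \<le> (\<Squnion>g. cell x g M)"
        by (rule le_SUPI[of "\<lambda>a. f a = 1"]) (simp_all add: cell_def u_def)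
    qed
    finally show "(\<Squnion>g. cell x g M) = \<top>"
      by (simp add: top.extremum_unique)
  qed
next
  assume cells: "\<forall>x :: 'm \<Rightarrow> 'b. (\<Squnion>g. cell x g M) = \<top>"
  show "distributive TYPE('b) M {..<2::nat}"
    unfolding distributive_def
  proof (intro allI antisym)
    fix u :: "'m \<Rightarrow> nat \<Rightarrow> 'b"
    let ?l = "\<Sqinter>a\<in>M. \<Squnion>c\<in>{..<2}. u a c" and ?r = "\<Squnion>f\<in>M \<rightarrow>\<^sub>E {..<2}. \<Sqinter>a\<in>M. u a (f a)"
    show "?r \<le> ?l"
      by (intro SUP_least INF_greatest, rule order_trans[OF INF_lower SUP_upper]) auto
    have "?l \<le> (\<Squnion>g. cell (\<lambda>a. u a 1) g M)"
      by (simp add: cells)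
    then show "?l \<le> ?r"
    proof (rule le_SUPE)
      fix g q assume q: "q \<le> ?l" "q \<le> cell (\<lambda>a. u a 1) g M"
      show "q \<le> ?r"
      proof (intro le_SUPI[of "\<lambda>a\<in>M. if g a then 1 else 0"] INF_greatest)
        fix a assume a: "a \<in> M"
        have "q \<le> u a 0 \<squnion> u a 1"
          using le_INFD[OF q(1) a] by (simp add: numeral_2_eq_2 lessThan_Suc sup.commute)
        then have "q \<le> u a (if g a then 1 else 0)"
        proof (rule le_supE)
          fix p assume p: "p \<le> q" "p \<le> u a 0"
          have "p \<le> lit (u a 1) (g a)"
            by (rule order_trans[OF p(1) le_cellD[OF q(2) a]])
          with p(2) show "p \<le> u a (if g a then 1 else 0)"
            by (simp add: lit_def split: if_splits)
        next
          fix p assume p: "p \<le> q" "p \<le> u a 1"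
          have "p \<le> lit (u a 1) (g a)"
            by (rule order_trans[OF p(1) le_cellD[OF q(2) a]])
          with p(2) show "p \<le> u a (if g a then 1 else 0)"
            using le_uminusD[of p "u a 1"] by (simp add: lit_def split: if_splits)
        qed
        then show "q \<le> u a ((\<lambda>a\<in>M. if g a then 1 else 0) a)"
          using a by simp
      qed auto
    qed
  qed
qed

text \<open>
  Here \<open>s\<close> and \<open>t\<close> stand for sets of natural numbers in the extension, given by the values of \<open>n \<in> s\<close> and
  \<open>n \<in> t\<close>. The definition is the value of the statement that \<open>s\<close> is almost contained in \<open>t\<close>.
\<close>

definition almost_le :: "(nat \<Rightarrow> 'b) \<Rightarrow> (nat \<Rightarrow> 'b) \<Rightarrow> 'b::complete_ba" where
  "almost_le s t = (\<Squnion>m. \<Sqinter>n\<in>{m..}. s n \<rightarrow>\<^sub>B t n)"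

lemma le_almost_le_mono:
  fixes p :: "'b::complete_ba"
  assumes "p \<le> almost_le s t" and "\<And>n q. q \<le> p \<Longrightarrow> q \<le> t n \<Longrightarrow> q \<le> t' n"
  shows "p \<le> almost_le s t'"
  using assms(1) unfolding almost_le_def
proof (rule le_SUPE)
  fix m q assume q: "q \<le> p" "q \<le> (\<Sqinter>n\<in>{m..}. s n \<rightarrow>\<^sub>B t n)"
  show "q \<le> (\<Squnion>m. \<Sqinter>n\<in>{m..}. s n \<rightarrow>\<^sub>B t' n)"
  proof (intro le_SUPI[of m] INF_greatest le_bimpI)
    fix n q' assume n: "n \<in> {m..}" "q' \<le> q" "q' \<le> s n"
    have "q' \<le> t n"
      by (rule le_bimpD[OF order_trans[OF n(2) le_INFD[OF q(2) n(1)]] n(3)])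
    then show "q' \<le> t' n"
      using assms(2)[of q' n] n(2) q(1) by auto
  qed simp
qed

text \<open>
  Almost inclusion between sets of the ground model is absolute.
\<close>

lemma almost_le_lit:
  "almost_le (\<lambda>n. lit \<top> (n \<in> X)) (\<lambda>n. lit \<top> (n \<in> Y)) = (lit \<top> (finite (X - Y)) :: 'b::complete_ba)"
proof (cases "finite (X - Y)")
  case True
  then obtain m where "n < m" if "n \<in> X - Y" for n
    by (auto simp: finite_nat_set_iff_bounded)
  then have "n \<in> X \<longrightarrow> n \<in> Y" if "n \<in> {m..}" for n
    using that by (metis DiffI atLeast_iff leD)
  then have "(\<top> :: 'b) \<le> almost_le (\<lambda>n. lit \<top> (n \<in> X)) (\<lambda>n. lit \<top> (n \<in> Y))"
    unfolding almost_le_def by (intro le_SUPI[of m] INF_greatest) (auto simp: lit_def bimp_def)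
  with True show ?thesis
    by (simp add: lit_def top.extremum_unique)
next
  case False
  have "almost_le (\<lambda>n. lit \<top> (n \<in> X)) (\<lambda>n. lit \<top> (n \<in> Y)) \<le> (\<bottom> :: 'b)"
    unfolding almost_le_def
  proof (rule SUP_least)
    fix m
    obtain n where "n \<ge> m" "n \<in> X - Y"
      using False unfolding infinite_nat_iff_unbounded_le by blast
    then show "(\<Sqinter>n\<in>{m..}. lit \<top> (n \<in> X) \<rightarrow>\<^sub>B lit \<top> (n \<in> Y)) \<le> (\<bottom> :: 'b)"
      by (intro INF_lower2[of n]) (auto simp: lit_def bimp_def)
  qed
  with False show ?thesis
    by (simp add: lit_def bot.extremum_unique)
qed

section \<open>Equality and membership of names\<close>

lemma elts_induct [case_names elts]:
  assumes "\<And>x. (\<And>y c. (y, c) \<in> elts x \<Longrightarrow> P y) \<Longrightarrow> P x"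
  shows "P (x :: ('i, 'b) bname)"
  using wf_elt_rel
proof (induction x rule: wf_induct_rule)
  case (less x)
  then show ?case
    by (rule assms) (auto simp: elt_rel_def)
qed

text \<open>
  The defining equation is symmetric except for the order of the arguments in the recursive calls, which the
  induction hypothesis takes care of.
\<close>

lemma beq_sym: "(x :: ('i, 'b::complete_ba) bname) =\<^sub>B y = y =\<^sub>B x"
proof (induction x arbitrary: y rule: elts_induct)
  case (elts x)
  have *: "fst p =\<^sub>B z = z =\<^sub>B fst p" if "p \<in> elts x" for p z
    using elts[of "fst p" "snd p"] that by simp
  have "(\<Squnion>p\<in>elts x. (fst p =\<^sub>B z) \<sqinter> snd p) = (\<Squnion>p\<in>elts x. (z =\<^sub>B fst p) \<sqinter> snd p)" for z
    by (intro SUP_cong refl arg_cong2[where f = inf] *)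
  moreover have "(\<Squnion>q\<in>elts y. (fst p =\<^sub>B fst q) \<sqinter> snd q) = (\<Squnion>q\<in>elts y. (fst q =\<^sub>B fst p) \<sqinter> snd q)"
    if "p \<in> elts x" for p
    by (intro SUP_cong refl arg_cong2[where f = inf] * that)
  ultimately show ?case
    unfolding beq.simps[of x y] beq.simps[of y x]
    by (subst inf.commute) (auto intro!: arg_cong2[where f = inf] INF_cong)
qed

lemma beq_eq_bmem:
  "x =\<^sub>B y = (\<Sqinter>p\<in>elts x. snd p \<rightarrow>\<^sub>B fst p \<in>\<^sub>B y) \<sqinter> (\<Sqinter>q\<in>elts y. snd q \<rightarrow>\<^sub>B fst q \<in>\<^sub>B x)"
proof -
  have "z \<in>\<^sub>B x = (\<Squnion>p\<in>elts x. (fst p =\<^sub>B z) \<sqinter> snd p)" for z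
    unfolding bmem_def by (intro SUP_cong refl arg_cong2[where f = inf] beq_sym)
  then show ?thesis
    unfolding beq.simps[of x y] bmem_def[of _ y] by (simp only:)
qed

lemma le_beqD1: "p \<le> x =\<^sub>B y \<Longrightarrow> (z, c) \<in> elts x \<Longrightarrow> p \<le> c \<Longrightarrow> p \<le> z \<in>\<^sub>B y"
  unfolding beq_eq_bmem le_inf_iff by (auto dest!: le_INFD[of p _ "elts x" "(z, c)"] intro: le_bimpD[of p c])

lemma le_bmemI: "(z, c) \<in> elts x \<Longrightarrow> p \<le> y =\<^sub>B z \<Longrightarrow> p \<le> c \<Longrightarrow> p \<le> y \<in>\<^sub>B x"
  unfolding bmem_def by (rule le_SUPI[of "(z, c)"]) simp_all

lemma le_bmemE:
  assumes "p \<le> y \<in>\<^sub>B x"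
    and "\<And>z c q. (z, c) \<in> elts x \<Longrightarrow> q \<le> p \<Longrightarrow> q \<le> y =\<^sub>B z \<Longrightarrow> q \<le> c \<Longrightarrow> q \<le> d"
  shows "p \<le> d"
  using assms(1) unfolding bmem_def by (rule le_SUPE) (rule assms(2)[of "fst _" "snd _"], auto)

text \<open>
  Extensionality. An element of \<open>x\<close> belongs to \<open>x\<close> with the value attached to it only if it equals itself, so
  reflexivity at the elements is a hypothesis: this makes the lemma usable in the proof of \<open>beq_refl\<close>.
\<close>

lemma le_beqI:
  assumes "\<And>z q. q \<le> p \<Longrightarrow> q \<le> z \<in>\<^sub>B x \<Longrightarrow> q \<le> z \<in>\<^sub>B y"
    and "\<And>z q. q \<le> p \<Longrightarrow> q \<le> z \<in>\<^sub>B y \<Longrightarrow> q \<le> z \<in>\<^sub>B x"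
    and refl: "\<And>z c. (z, c) \<in> elts x \<union> elts y \<Longrightarrow> z =\<^sub>B z = \<top>"
  shows "p \<le> x =\<^sub>B y"
proof -
  have *: "q \<le> fst u \<in>\<^sub>B v" if "q \<le> snd u" "u \<in> elts v" "v = x \<or> v = y" for q u v
    using that refl[of "fst u" "snd u"] by (intro le_bmemI[of "fst u" "snd u"]) auto
  show ?thesis
    unfolding beq_eq_bmem le_inf_iff le_INF_iff
  proof (intro conjI ballI le_bimpI)
    fix u q assume "u \<in> elts x" "q \<le> p" "q \<le> snd u"
    then show "q \<le> fst u \<in>\<^sub>B y"
      by (intro assms(1)[OF _ *]) simp_all
  next
    fix u q assume "u \<in> elts y" "q \<le> p" "q \<le> snd u"
    then show "q \<le> fst u \<in>\<^sub>B x"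
      by (intro assms(2)[OF _ *]) simp_all
  qed
qed

lemma beq_refl [simp]: "x =\<^sub>B x = \<top>"
proof (induction x rule: elts_induct)
  case (elts x)
  then have "\<top> \<le> x =\<^sub>B x"
    by (intro le_beqI) auto
  then show ?case by (simp add: top.extremum_unique)
qed

lemmas le_beq_ext = le_beqI[OF _ _ beq_refl]

lemma le_beq_sym: "p \<le> x =\<^sub>B y \<Longrightarrow> p \<le> y =\<^sub>B x"
  by (simp add: beq_sym)

text \<open>
  An element of \<open>x\<close> is matched with one of \<open>y\<close> and then with one of \<open>z\<close>, and conversely. In both directions the
  induction hypothesis is applied to an element of \<open>x\<close>; for the converse this takes two uses of symmetry.
\<close>

lemma le_beq_trans: "p \<le> x =\<^sub>B y \<Longrightarrow> p \<le> y =\<^sub>B z \<Longrightarrow> p \<le> x =\<^sub>B z"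
proof (induction x arbitrary: y z p rule: elts_induct)
  case (elts x)
  have *: "q \<le> u \<in>\<^sub>B z" if "(u, c) \<in> elts x" "q \<le> x =\<^sub>B y" "q \<le> y =\<^sub>B z" "q \<le> c" for u c q y z
    using le_beqD1[OF that(2,1,4)]
  proof (rule le_bmemE)
    fix v d r assume r: "(v, d) \<in> elts y" "r \<le> q" "r \<le> u =\<^sub>B v" "r \<le> d"
    have "r \<le> v \<in>\<^sub>B z"
      by (rule le_beqD1[OF order_trans[OF r(2) that(3)] r(1,4)])
    then show "r \<le> u \<in>\<^sub>B z"
    proof (rule le_bmemE)
      fix w e s assume s: "(w, e) \<in> elts z" "s \<le> r" "s \<le> v =\<^sub>B w" "s \<le> e"
      have "s \<le> u =\<^sub>B w"
        by (rule elts.IH[OF that(1) order_trans[OF s(2) r(3)] s(3)])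
      then show "s \<le> u \<in>\<^sub>B z"
        by (rule le_bmemI[OF s(1) _ s(4)])
    qed
  qed
  have **: "q \<le> u \<in>\<^sub>B x" if "(u, c) \<in> elts z" "q \<le> x =\<^sub>B y" "q \<le> y =\<^sub>B z" "q \<le> c" for u c q
    using le_beqD1[OF le_beq_sym[OF that(3)] that(1,4)]
  proof (rule le_bmemE)
    fix v d r assume r: "(v, d) \<in> elts y" "r \<le> q" "r \<le> u =\<^sub>B v" "r \<le> d"
    have "r \<le> v \<in>\<^sub>B x"
      by (rule le_beqD1[OF le_beq_sym[OF order_trans[OF r(2) that(2)]] r(1,4)])
    then show "r \<le> u \<in>\<^sub>B x"
    proof (rule le_bmemE)
      fix w e s assume s: "(w, e) \<in> elts x" "s \<le> r" "s \<le> v =\<^sub>B w" "s \<le> e"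
      have "s \<le> w =\<^sub>B u"
        by (rule elts.IH[OF s(1) le_beq_sym[OF s(3)] order_trans[OF s(2) le_beq_sym[OF r(3)]]])
      then show "s \<le> u \<in>\<^sub>B x"
        by (rule le_bmemI[OF s(1) le_beq_sym s(4)])
    qed
  qed
  have "p \<le> snd u \<rightarrow>\<^sub>B fst u \<in>\<^sub>B z" if "u \<in> elts x" for u
    using that elts.prems[THEN order_trans[rotated]] by (intro le_bimpI *[of "fst u" "snd u" _ y]) auto
  moreover have "p \<le> snd u \<rightarrow>\<^sub>B fst u \<in>\<^sub>B x" if "u \<in> elts z" for u
    using that elts.prems[THEN order_trans[rotated]] by (intro le_bimpI **[of "fst u" "snd u"]) auto
  ultimately show ?case
    unfolding beq_eq_bmem[of x z] by (simp add: le_INF_iff)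
qed

lemma le_bmem_subst1: "p \<le> x \<in>\<^sub>B z \<Longrightarrow> p \<le> x =\<^sub>B y \<Longrightarrow> p \<le> y \<in>\<^sub>B z"
proof (erule le_bmemE)
  fix u c q assume p: "p \<le> x =\<^sub>B y" and u: "(u, c) \<in> elts z" "q \<le> p" "q \<le> x =\<^sub>B u" "q \<le> c"
  have "q \<le> y =\<^sub>B u"
    by (rule le_beq_trans[OF le_beq_sym[OF order_trans[OF u(2) p]] u(3)])
  with u show "q \<le> y \<in>\<^sub>B z"
    by (intro le_bmemI)
qed

lemma le_bmem_subst2: "p \<le> z \<in>\<^sub>B x \<Longrightarrow> p \<le> x =\<^sub>B y \<Longrightarrow> p \<le> z \<in>\<^sub>B y"
proof (erule le_bmemE)
  fix u c q assume p: "p \<le> x =\<^sub>B y" and u: "(u, c) \<in> elts x" "q \<le> p" "q \<le> z =\<^sub>B u" "q \<le> c"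
  have "q \<le> u \<in>\<^sub>B y"
    by (rule le_beqD1[OF order_trans[OF u(2) p] u(1,4)])
  then show "q \<le> z \<in>\<^sub>B y"
    by (rule le_bmem_subst1[OF _ le_beq_sym[OF u(3)]])
qed

text \<open>
  Foundation: if \<open>x \<in> x\<close> has a nonzero value, then so has \<open>z \<in> z\<close> for some element \<open>z\<close> of the tree \<open>x\<close>.
\<close>

lemma bmem_irrefl: "x \<in>\<^sub>B x = \<bottom>"
proof (induction x rule: elts_induct)
  case (elts x)
  have "x \<in>\<^sub>B x \<le> \<bottom>"
  proof (rule le_bmemE[OF order_refl])
    fix z c q assume z: "(z, c) \<in> elts x" "q \<le> x =\<^sub>B z" "q \<le> c"
    have "q \<le> z \<in>\<^sub>B x"
      using z by (auto intro: le_bmemI)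
    then have "q \<le> z \<in>\<^sub>B z"
      using z(2) by (rule le_bmem_subst2)
    then show "q \<le> \<bottom>" using elts z(1) by auto
  qed
  then show ?case by (simp add: bot.extremum_unique)
qed

lemma elts_imp_beq_bot: "(y, \<top>) \<in> elts x \<Longrightarrow> x =\<^sub>B y = \<bottom>"
proof -
  assume y: "(y, \<top>) \<in> elts x"
  have "x =\<^sub>B y \<le> y \<in>\<^sub>B y"
    by (rule le_beqD1[OF order_refl y]) simp
  then show ?thesis
    by (simp add: bmem_irrefl bot.extremum_unique)
qed

lemma le_not_bmem_subst1:
  assumes "p \<le> - (x \<in>\<^sub>B z)" "p \<le> x =\<^sub>B y"
  shows "p \<le> - (y \<in>\<^sub>B z)"
proof (rule le_uminusI)
  fix q assume q: "q \<le> p" "q \<le> y \<in>\<^sub>B z"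
  show "q \<le> \<bottom>"
    by (rule le_uminusD[OF order_trans[OF q(1) assms(1)]],
        rule le_bmem_subst1[OF q(2) le_beq_sym[OF order_trans[OF q(1) assms(2)]]])
qed

lemma le_bsubsetD: "p \<le> x \<subseteq>\<^sub>B y \<Longrightarrow> p \<le> z \<in>\<^sub>B x \<Longrightarrow> p \<le> z \<in>\<^sub>B y"
  unfolding bsubset_def by (drule le_INFD[OF _ UNIV_I]) (rule le_bimpD)

section \<open>Names for pairs and graphs\<close>

definition family :: "'i set \<Rightarrow> ('i \<Rightarrow> ('i, 'b) bname \<times> 'b) \<Rightarrow> ('i, 'b) bname" where
  "family A f = BName (\<lambda>i. if i \<in> A then Some (f i) else None)"

lemma elts_family [simp]: "elts (family A f) = f ` A"
  by (force simp: family_def ran_def image_iff split: if_splits)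

text \<open>
  Names have their elements indexed by \<open>'i\<close>. An injection of the natural numbers into \<open>'i\<close> provides names whose
  elements are indexed by natural numbers, in particular pairs and \<open>\<omega>\<close>.
\<close>

locale nat_index =
  fixes e :: "nat \<Rightarrow> 'i"
  assumes inj_e: "inj e"
begin

definition nat_family :: "nat set \<Rightarrow> (nat \<Rightarrow> ('i, 'b) bname \<times> 'b) \<Rightarrow> ('i, 'b) bname" where
  "nat_family N f = family (e ` N) (f \<circ> inv e)"

lemma elts_nat_family [simp]: "elts (nat_family N f) = f ` N"
  by (simp add: nat_family_def image_comp inv_f_f[OF inj_e] cong: image_cong)

lemma bmem_nat_family: "z \<in>\<^sub>B nat_family N (\<lambda>n. (f n, c n)) = (\<Squnion>n\<in>N. z =\<^sub>B f n \<sqinter> c n)"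
  by (simp add: bmem_def image_comp)

definition upair :: "('i, 'b::complete_ba) bname \<Rightarrow> ('i, 'b) bname \<Rightarrow> ('i, 'b) bname" where
  "upair x y = nat_family {0, 1} (\<lambda>n. (if n = 0 then x else y, \<top>))"

definition kpair :: "('i, 'b::complete_ba) bname \<Rightarrow> ('i, 'b) bname \<Rightarrow> ('i, 'b) bname" where
  "kpair x y = upair (upair x x) (upair x y)"

lemma bmem_upair: "z \<in>\<^sub>B upair x y = z =\<^sub>B x \<squnion> z =\<^sub>B y"
  by (simp add: upair_def bmem_nat_family)

lemma le_is_upair_iff: "p \<le> is_upair r x y \<longleftrightarrow> p \<le> r =\<^sub>B upair x y"
proof
  assume p: "p \<le> is_upair r x y"
  have z: "q \<le> z \<in>\<^sub>B r \<leftrightarrow>\<^sub>B z \<in>\<^sub>B upair x y" if "q \<le> p" for q z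
    using order_trans[OF that p] by (auto simp: is_upair_def bmem_upair dest: le_INFD)
  show "p \<le> r =\<^sub>B upair x y"
    by (rule le_beq_ext; rule le_biffD1[OF z] le_biffD2[OF z]; assumption)
next
  assume p: "p \<le> r =\<^sub>B upair x y"
  then show "p \<le> is_upair r x y"
    unfolding is_upair_def bmem_upair[symmetric]
    by (intro INF_greatest le_biffI) (auto elim!: le_bmem_subst2 intro: order_trans le_beq_sym)
qed

lemma le_upair_cong:
  assumes "p \<le> x =\<^sub>B x'" "p \<le> y =\<^sub>B y'"
  shows "p \<le> upair x y =\<^sub>B upair x' y'"
proof -
  note a = assms[THEN order_trans[rotated]]
  have *: "q \<le> z \<in>\<^sub>B upair x' y'"
    if "q \<le> z \<in>\<^sub>B upair x y" and q: "q \<le> x =\<^sub>B x'" "q \<le> y =\<^sub>B y'" for q z x y x' y'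
    using that(1) unfolding bmem_upair
  proof (rule le_supE)
    fix r assume "r \<le> q" "r \<le> z =\<^sub>B x"
    then show "r \<le> z =\<^sub>B x' \<squnion> z =\<^sub>B y'"
      using le_beq_trans[of r z x x'] q(1) by (auto intro: le_supI1)
  next
    fix r assume "r \<le> q" "r \<le> z =\<^sub>B y"
    then show "r \<le> z =\<^sub>B x' \<squnion> z =\<^sub>B y'"
      using le_beq_trans[of r z y y'] q(2) by (auto intro: le_supI2)
  qed
  show ?thesis
    by (rule le_beq_ext[OF *[OF _ a] *[OF _ a[THEN le_beq_sym]]])
qed

lemma le_kpair_cong: "p \<le> x =\<^sub>B x' \<Longrightarrow> p \<le> y =\<^sub>B y' \<Longrightarrow> p \<le> kpair x y =\<^sub>B kpair x' y'"
  by (simp add: kpair_def le_upair_cong)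

text \<open>
  The two existential quantifiers in \<open>is_pair\<close> disappear because pairs have explicit names. This turns \<open>maps_to\<close>
  into a membership statement.
\<close>

lemma is_pair_eq: "is_pair z x y = z =\<^sub>B kpair x y"
proof (rule antisym)
  show "is_pair z x y \<le> z =\<^sub>B kpair x y"
    unfolding is_pair_def
  proof (intro SUP_least)
    fix r s
    let ?p = "is_upair r x x \<sqinter> is_upair s x y \<sqinter> is_upair z r s"
    have "?p \<le> r =\<^sub>B upair x x" "?p \<le> s =\<^sub>B upair x y" "?p \<le> z =\<^sub>B upair r s"
      unfolding le_is_upair_iff[symmetric] by (auto intro: le_infI1)
    then show "?p \<le> z =\<^sub>B kpair x y"
      unfolding kpair_def by (blast intro: le_beq_trans le_upair_cong)
  qed
next
  have "z =\<^sub>B kpair x y \<le> is_upair (upair x x) x x \<sqinter> is_upair (upair x y) x y \<sqinter> is_upair z (upair x x) (upair x y)"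
    by (simp add: le_is_upair_iff kpair_def)
  then show "z =\<^sub>B kpair x y \<le> is_pair z x y"
    unfolding is_pair_def by (blast intro: le_SUPI)
qed

text \<open>
  The singleton of \<open>x\<close> belongs to the second pair, so it is the singleton of \<open>x'\<close> or the pair set of \<open>x'\<close> and
  \<open>y'\<close>. In both cases \<open>x'\<close> is an element of the singleton of \<open>x\<close>.
\<close>

lemma le_kpair_fstD: "p \<le> kpair x y =\<^sub>B kpair x' y' \<Longrightarrow> p \<le> x =\<^sub>B x'"
proof -
  assume "p \<le> kpair x y =\<^sub>B kpair x' y'"
  moreover have "p \<le> upair x x \<in>\<^sub>B kpair x y"
    by (simp add: kpair_def bmem_upair)
  ultimately have "p \<le> upair x x \<in>\<^sub>B kpair x' y'"
    by (rule le_bmem_subst2[rotated])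
  then have "p \<le> upair x x =\<^sub>B upair x' x' \<squnion> upair x x =\<^sub>B upair x' y'"
    by (simp add: kpair_def bmem_upair)
  moreover have "q \<le> x =\<^sub>B x'" if "q \<le> upair x x =\<^sub>B upair x' y''" for q y''
  proof -
    have "q \<le> x' \<in>\<^sub>B upair x' y''" by (simp add: bmem_upair)
    from le_bmem_subst2[OF this le_beq_sym[OF that]] show ?thesis
      by (simp add: bmem_upair beq_sym)
  qed
  ultimately show ?thesis
    by (elim le_supE)
qed

text \<open>
  As in the usual proof for Kuratowski pairs, \<open>y\<close> is \<open>x'\<close> or \<open>y'\<close>, and \<open>y'\<close> is \<open>x\<close> or \<open>y\<close>. The only case in
  which this does not give \<open>y = y'\<close> at once is \<open>y = x'\<close> and \<open>y' = x\<close>, and there the first components help.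
\<close>

lemma le_kpair_sndD:
  assumes p: "p \<le> kpair x y =\<^sub>B kpair x' y'"
  shows "p \<le> y =\<^sub>B y'"
proof -
  have *: "q \<le> y =\<^sub>B x' \<squnion> y =\<^sub>B y'" if q: "q \<le> kpair x y =\<^sub>B kpair x' y'" for q x y x' y'
  proof -
    have "q \<le> upair x y \<in>\<^sub>B kpair x y"
      by (simp add: kpair_def bmem_upair)
    then have "q \<le> upair x y \<in>\<^sub>B kpair x' y'"
      using q by (rule le_bmem_subst2)
    then have "q \<le> upair x y =\<^sub>B upair x' x' \<squnion> upair x y =\<^sub>B upair x' y'"
      by (simp add: kpair_def bmem_upair)
    moreover have "q' \<le> y =\<^sub>B x' \<squnion> y =\<^sub>B y''" if "q' \<le> upair x y =\<^sub>B upair x' y''" for q' y''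
    proof -
      have "q' \<le> y \<in>\<^sub>B upair x y" by (simp add: bmem_upair)
      from le_bmem_subst2[OF this that] show ?thesis
        by (simp add: bmem_upair)
    qed
    note this[of _ x'] this[of _ y']
    ultimately show ?thesis
      by (elim le_supE) (auto intro: le_supI1)
  qed
  have x: "p \<le> x =\<^sub>B x'"
    by (rule le_kpair_fstD[OF p])
  from *[OF p] show ?thesis
  proof (rule le_supE)
    fix q assume q: "q \<le> p" "q \<le> y =\<^sub>B x'"
    from *[OF le_beq_sym[OF order_trans[OF q(1) p]]]
    have "q \<le> y' =\<^sub>B x \<squnion> y' =\<^sub>B y" .
    then show "q \<le> y =\<^sub>B y'"
    proof (rule le_supE)
      fix r assume r: "r \<le> q" "r \<le> y' =\<^sub>B x"
      have "r \<le> x =\<^sub>B x'" "r \<le> y =\<^sub>B x'"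
        using r(1) q x by (auto intro: order_trans)
      then show "r \<le> y =\<^sub>B y'"
        using r(2) by (blast intro: le_beq_trans le_beq_sym)
    qed (rule le_beq_sym)
  qed
qed

lemma kpair_eq: "kpair x y =\<^sub>B kpair x' y' = x =\<^sub>B x' \<sqinter> y =\<^sub>B y'"
  by (intro antisym le_infI le_kpair_cong) (auto intro: le_kpair_fstD le_kpair_sndD)

lemma maps_to_eq: "maps_to F x y = kpair x y \<in>\<^sub>B F"
proof (rule antisym)
  show "maps_to F x y \<le> kpair x y \<in>\<^sub>B F"
    unfolding maps_to_def is_pair_eq
    by (intro SUP_least) (rule le_bmem_subst1[OF inf_le2 inf_le1])
  show "kpair x y \<in>\<^sub>B F \<le> maps_to F x y"
    unfolding maps_to_def is_pair_eq by (rule le_SUPI[of "kpair x y"]) auto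
qed

text \<open>
  After this lemma, statements about a function with an explicit graph involve only equality of names.
\<close>

lemma maps_to_graph:
  assumes "elts F = (\<lambda>a. (kpair (f a) (g a), \<top>)) ` A"
  shows "maps_to F x y = (\<Squnion>a\<in>A. x =\<^sub>B f a \<sqinter> y =\<^sub>B g a)"
  unfolding maps_to_eq bmem_def assms by (simp add: image_comp kpair_eq)

lemma le_maps_to_subst:
  fixes F :: "('i, 'b::complete_ba) bname"
  shows "p \<le> maps_to F x y \<Longrightarrow> p \<le> x =\<^sub>B x' \<Longrightarrow> p \<le> y =\<^sub>B y' \<Longrightarrow> p \<le> maps_to F x' y'"
  unfolding maps_to_eq by (rule le_bmem_subst1[OF _ le_kpair_cong])

end

section \<open>Names for the natural numbers\<close>

context nat_index
begin

text \<open>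
  The case distinction in the body only makes the recursion visibly well-founded; see \<open>elts_nat_name\<close>.
\<close>

function nat_name :: "nat \<Rightarrow> ('i, 'b::complete_ba) bname" where
  "nat_name n = nat_family {..<n} (\<lambda>k. if k < n then (nat_name k, \<top>) else undefined)"
  by auto
termination
  by (relation less_than) auto

declare nat_name.simps [simp del]

lemma elts_nat_name: "elts (nat_name n) = (\<lambda>k. (nat_name k, \<top>)) ` {..<n}"
  by (subst nat_name.simps) auto

definition omega :: "('i, 'b::complete_ba) bname" where
  "omega = nat_family UNIV (\<lambda>n. (nat_name n, \<top>))"

lemma bmem_nat_name: "z \<in>\<^sub>B nat_name n = (\<Squnion>k\<in>{..<n}. z =\<^sub>B nat_name k)"
  by (simp add: bmem_def elts_nat_name image_comp)

lemma bmem_nat_name_0 [simp]: "z \<in>\<^sub>B nat_name 0 = \<bottom>"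
  by (simp add: bmem_nat_name)

lemma bmem_nat_name_Suc: "z \<in>\<^sub>B nat_name (Suc n) = z \<in>\<^sub>B nat_name n \<squnion> z =\<^sub>B nat_name n"
  by (simp add: bmem_nat_name lessThan_Suc sup.commute)

lemma bmem_omega: "z \<in>\<^sub>B omega = (\<Squnion>n. z =\<^sub>B nat_name n)"
  by (simp add: omega_def bmem_nat_family)

lemma nat_name_in_omega [simp]: "nat_name n \<in>\<^sub>B omega = \<top>"
proof -
  have "\<top> \<le> nat_name n \<in>\<^sub>B omega"
    unfolding bmem_omega by (rule le_SUPI[of n]) auto
  then show ?thesis by (simp add: top.extremum_unique)
qed

lemma nat_name_neq: "m \<noteq> n \<Longrightarrow> (nat_name m :: ('i, 'b::complete_ba) bname) =\<^sub>B nat_name n = \<bottom>"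
proof (induction m n rule: linorder_less_wlog)
  case (less m n)
  then have "(nat_name m, \<top>) \<in> elts (nat_name n :: ('i, 'b) bname)"
    by (simp add: elts_nat_name)
  from elts_imp_beq_bot[OF this] show ?case
    by (simp add: beq_sym)
qed (auto simp: beq_sym)

lemma le_nat_name_inj: "p \<le> x =\<^sub>B nat_name m \<Longrightarrow> p \<le> x =\<^sub>B nat_name n \<Longrightarrow> m \<noteq> n \<Longrightarrow> p \<le> c"
  for x :: "('i, 'b::complete_ba) bname"
  using le_beq_trans[OF le_beq_sym, of p x "nat_name m" "nat_name n"] nat_name_neq[of m n, where 'b = 'b]
  by (auto simp: bot.extremum_unique)

text \<open>
  \<open>x\<close> is allowed to be merely forced equal to a natural number, since this is what \<open>x \<in> \<omega>\<close> yields.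
\<close>

lemma is_suc_nat_name: "p \<le> x =\<^sub>B nat_name n \<Longrightarrow> p \<le> is_suc y x \<longleftrightarrow> p \<le> y =\<^sub>B nat_name (Suc n)"
  for x :: "('i, 'b::complete_ba) bname"
proof
  assume p: "p \<le> x =\<^sub>B nat_name n"
  have x: "r \<le> z \<in>\<^sub>B x \<squnion> z =\<^sub>B x \<longleftrightarrow> r \<le> z \<in>\<^sub>B nat_name (Suc n)" if "r \<le> p" for r z
  proof -
    note r = order_trans[OF that p]
    have "s \<le> z \<in>\<^sub>B x \<longleftrightarrow> s \<le> z \<in>\<^sub>B nat_name n" "s \<le> z =\<^sub>B x \<longleftrightarrow> s \<le> z =\<^sub>B nat_name n" if "s \<le> r" for s
      using le_bmem_subst2[OF _ order_trans[OF that r]] le_bmem_subst2[OF _ le_beq_sym[OF order_trans[OF that r]]]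
        le_beq_trans[OF _ order_trans[OF that r]] le_beq_trans[OF _ le_beq_sym[OF order_trans[OF that r]]]
      by blast+
    then show ?thesis
      unfolding bmem_nat_name_Suc by (intro iffI; elim le_supE) (auto intro: le_supI1 le_supI2)
  qed
  {
    assume p: "p \<le> is_suc y x"
    have "r \<le> z \<in>\<^sub>B y \<leftrightarrow>\<^sub>B z \<in>\<^sub>B x \<squnion> z =\<^sub>B x" if "r \<le> p" for r z
      using order_trans[OF that p] unfolding is_suc_def by (auto dest: le_INFD)
    then show "p \<le> y =\<^sub>B nat_name (Suc n)"
      by (intro le_beq_ext) (auto simp: x[symmetric] intro: le_biffD1 le_biffD2)
  next
    assume y: "p \<le> y =\<^sub>B nat_name (Suc n)"
    note y' = order_trans[OF _ y]
    have "r \<le> z \<in>\<^sub>B y \<longleftrightarrow> r \<le> z \<in>\<^sub>B nat_name (Suc n)" if "r \<le> p" for r z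
      using le_bmem_subst2[OF _ y'[OF that], of z] le_bmem_subst2[OF _ le_beq_sym[OF y'[OF that]], of z]
      by blast
    then show "p \<le> is_suc y x"
      unfolding is_suc_def by (intro INF_greatest le_biffI) (simp_all add: x)
  }
qed

text \<open>
  Every inductive set contains all \<open>nat_name n\<close>, by induction on \<open>n\<close> outside the Boolean-valued universe.
\<close>

lemma is_omega_omega: "is_omega (omega :: ('i, 'b::complete_ba) bname) = \<top>"
proof -
  have "\<top> \<le> is_inductive (omega :: ('i, 'b) bname)"
    unfolding is_inductive_def
  proof (intro le_infI INF_greatest le_bimpI)
    show "\<top> \<le> (\<Squnion>e. is_empty e \<sqinter> e \<in>\<^sub>B (omega :: ('i, 'b) bname))"
      by (rule le_SUPI[of "nat_name 0"]) (simp_all add: is_empty_def)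
  next
    fix x :: "('i, 'b) bname" and q assume "q \<le> x \<in>\<^sub>B omega"
    then show "q \<le> (\<Squnion>y. is_suc y x \<sqinter> y \<in>\<^sub>B omega)"
      unfolding bmem_omega[of x]
    proof (rule le_SUPE)
      fix n r assume "r \<le> x =\<^sub>B nat_name n"
      then show "r \<le> (\<Squnion>y. is_suc y x \<sqinter> y \<in>\<^sub>B omega)"
        by (intro le_SUPI[of "nat_name (Suc n)"]) (simp_all add: is_suc_nat_name)
    qed
  qed
  moreover have "is_inductive v \<le> omega \<subseteq>\<^sub>B v" for v :: "('i, 'b) bname"
  proof -
    have n: "is_inductive v \<le> nat_name n \<in>\<^sub>B v" for n
    proof (induction n)
      case 0
      have "is_inductive v \<le> (\<Squnion>e. is_empty e \<sqinter> e \<in>\<^sub>B v)"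
        by (simp add: is_inductive_def)
      then show ?case
      proof (rule le_SUPE)
        fix e q assume "q \<le> is_empty e \<sqinter> e \<in>\<^sub>B v"
        then have e: "q \<le> is_empty e" "q \<le> e \<in>\<^sub>B v"
          by auto
        have "q \<le> e =\<^sub>B nat_name 0"
        proof (rule le_beq_ext)
          fix z r assume "r \<le> q" "r \<le> z \<in>\<^sub>B e"
          then show "r \<le> z \<in>\<^sub>B nat_name 0"
            using order_trans[OF _ e(1), of r] by (auto simp: is_empty_def dest: le_INFD intro: le_uminusD)
        qed (simp add: bot.extremum_unique)
        with e(2) show "q \<le> nat_name 0 \<in>\<^sub>B v"
          by (rule le_bmem_subst1)
      qed
    next
      case (Suc n)
      have "is_inductive v \<le> (\<Sqinter>x. x \<in>\<^sub>B v \<rightarrow>\<^sub>B (\<Squnion>y. is_suc y x \<sqinter> y \<in>\<^sub>B v))"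
        by (simp add: is_inductive_def)
      from le_bimpD[OF le_INFD[OF this UNIV_I] Suc] show ?case
      proof (rule le_SUPE)
        fix y q assume "q \<le> is_suc y (nat_name n) \<sqinter> y \<in>\<^sub>B v"
        then show "q \<le> nat_name (Suc n) \<in>\<^sub>B v"
          using is_suc_nat_name[of q "nat_name n" n y] by (auto intro: le_bmem_subst1)
      qed
    qed
    show ?thesis
      unfolding bsubset_def
    proof (intro INF_greatest le_bimpI)
      fix z q assume q: "q \<le> is_inductive v" "q \<le> z \<in>\<^sub>B omega"
      from q(2) show "q \<le> z \<in>\<^sub>B v"
        unfolding bmem_omega
      proof (rule le_SUPE)
        fix n r assume "r \<le> q" "r \<le> z =\<^sub>B nat_name n"
        then show "r \<le> z \<in>\<^sub>B v"
          using q(1) n[of n] by (intro le_bmem_subst1[of r "nat_name n" v z] le_beq_sym[of r z]) auto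
      qed
    qed
  qed
  then have "q \<le> omega \<subseteq>\<^sub>B v" if "q \<le> is_inductive v" for v :: "('i, 'b) bname" and q
    using that order_trans by blast
  ultimately have "\<top> \<le> is_omega (omega :: ('i, 'b) bname)"
    unfolding is_omega_def by (intro le_infI INF_greatest le_bimpI)
  then show ?thesis by (simp add: top.extremum_unique)
qed

section \<open>Functions and finite sets\<close>

lemma le_is_function_dom:
  fixes F :: "('i, 'b::complete_ba) bname"
  assumes "p \<le> is_function F d" "p \<le> maps_to F x y"
  shows "p \<le> x \<in>\<^sub>B d"
proof -
  have "p \<le> (\<Sqinter>p. p \<in>\<^sub>B F \<rightarrow>\<^sub>B (\<Squnion>x. \<Squnion>y. x \<in>\<^sub>B d \<sqinter> is_pair p x y))"
    using assms(1) by (simp add: is_function_def)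
  from le_bimpD[OF le_INFD[OF this UNIV_I] assms(2)[unfolded maps_to_eq]]
  have "p \<le> (\<Squnion>x'. \<Squnion>y'. x' \<in>\<^sub>B d \<sqinter> (x =\<^sub>B x' \<sqinter> y =\<^sub>B y'))"
    by (simp add: is_pair_eq kpair_eq)
  then show ?thesis
  proof (elim le_SUPE)
    fix x' y' q r assume "r \<le> x' \<in>\<^sub>B d \<sqinter> (x =\<^sub>B x' \<sqinter> y =\<^sub>B y')"
    then show "r \<le> x \<in>\<^sub>B d"
      by (intro le_bmem_subst1[of r x' d x] le_beq_sym[of r x x']) auto
  qed
qed

lemma le_is_functionD:
  assumes "p \<le> is_function F d" "p \<le> maps_to F x y" "p \<le> maps_to F x z"
  shows "p \<le> y =\<^sub>B z"
proof -
  have "p \<le> (\<Sqinter>x. \<Sqinter>y. \<Sqinter>z. maps_to F x y \<sqinter> maps_to F x z \<rightarrow>\<^sub>B y =\<^sub>B z)"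
    using assms(1) by (simp add: is_function_def)
  then have "p \<le> maps_to F x y \<sqinter> maps_to F x z \<rightarrow>\<^sub>B y =\<^sub>B z"
    by (simp add: le_INF_iff)
  then show ?thesis
    by (rule le_bimpD) (simp add: assms)
qed

text \<open>
  Different indices have incompatible arguments \<open>f a\<close>, so the graph is single-valued even if the values \<open>g a\<close> are
  arbitrary names.
\<close>

lemma is_function_graph:
  fixes f :: "'a \<Rightarrow> ('i, 'b::complete_ba) bname"
  assumes F: "elts F = (\<lambda>a. (kpair (f a) (g a), \<top>)) ` A"
    and d: "\<And>x. x \<in>\<^sub>B d = (\<Squnion>a\<in>A. x =\<^sub>B f a)"
    and inj: "\<And>a b. a \<in> A \<Longrightarrow> b \<in> A \<Longrightarrow> a \<noteq> b \<Longrightarrow> f a =\<^sub>B f b = \<bottom>"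
  shows "is_function F d = \<top>"
proof -
  note m = maps_to_graph[OF F]
  have "\<top> \<le> is_function F d"
    unfolding is_function_def
  proof (intro le_infI INF_greatest le_bimpI)
    fix q z assume "q \<le> z \<in>\<^sub>B F"
    then show "q \<le> (\<Squnion>x y. x \<in>\<^sub>B d \<sqinter> is_pair z x y)"
    proof (rule le_bmemE)
      fix r u c assume u: "(u, c) \<in> elts F" "r \<le> z =\<^sub>B u"
      from u(1) obtain a where a: "a \<in> A" "u = kpair (f a) (g a)"
        by (auto simp: F)
      have "r \<le> f a \<in>\<^sub>B d"
        unfolding d by (rule le_SUPI[OF a(1)]) simp
      with u(2) a(2) show "r \<le> (\<Squnion>x y. x \<in>\<^sub>B d \<sqinter> is_pair z x y)"
        by (intro le_SUPI[of "f a"] le_SUPI[of "g a"]) (auto simp: is_pair_eq)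
    qed
  next
    fix q x assume "q \<le> x \<in>\<^sub>B d"
    then show "q \<le> (\<Squnion>y. maps_to F x y)"
      unfolding d
    proof (rule le_SUPE)
      fix a r assume "a \<in> A" "r \<le> x =\<^sub>B f a"
      then show "r \<le> (\<Squnion>y. maps_to F x y)"
        by (intro le_SUPI[of "g a"]) (auto simp: m intro: le_SUPI)
    qed
  next
    fix q x y z assume "q \<le> maps_to F x y \<sqinter> maps_to F x z"
    then have q: "q \<le> maps_to F x y" "q \<le> maps_to F x z"
      by auto
    from q(1) show "q \<le> y =\<^sub>B z"
      unfolding m
    proof (rule le_SUPE)
      fix a r assume a: "a \<in> A" "r \<le> q" "r \<le> x =\<^sub>B f a \<sqinter> y =\<^sub>B g a"
      from order_trans[OF a(2) q(2)] show "r \<le> y =\<^sub>B z"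
        unfolding m
      proof (rule le_SUPE)
        fix b s assume b: "b \<in> A" "s \<le> r" "s \<le> x =\<^sub>B f b \<sqinter> z =\<^sub>B g b"
        have s: "s \<le> x =\<^sub>B f a" "s \<le> y =\<^sub>B g a" "s \<le> x =\<^sub>B f b" "s \<le> z =\<^sub>B g b"
          using a(3) b(2,3) by auto
        have "s \<le> f a =\<^sub>B f b"
          by (rule le_beq_trans[OF le_beq_sym[OF s(1)] s(3)])
        then have "a = b \<or> s = \<bottom>"
          using inj[OF a(1) b(1)] by (cases "a = b") (auto simp: bot.extremum_unique)
        then show "s \<le> y =\<^sub>B z"
          using le_beq_trans[OF s(2) le_beq_sym] s(4) by auto
      qed
    qed
  qed
  then show ?thesis by (simp add: top.extremum_unique)
qed

definition bounded :: "('i, 'b::complete_ba) bname \<Rightarrow> 'b" where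
  "bounded D = (\<Squnion>m. \<Sqinter>n\<in>{m..}. - (nat_name n \<in>\<^sub>B D))"

text \<open>
  Let \<open>F\<close> be a bijection from \<open>k\<close> onto \<open>D\<close>. For each \<open>i < k\<close> the numbers \<open>j\<close> with \<open>F i = j\<close> are bounded, because
  there is at most one. The maximum of \<open>k\<close> such bounds is a bound for \<open>D\<close>.
\<close>

lemma is_finite_le_bounded: "is_finite omega D \<le> bounded D"
  unfolding is_finite_def
proof (intro SUP_least)
  fix n F
  let ?p = "n \<in>\<^sub>B omega \<sqinter> is_bijection F n D"
  have "?p \<le> (\<Squnion>k. n =\<^sub>B nat_name k)"
    unfolding bmem_omega[symmetric] by simp
  then show "?p \<le> bounded D"
  proof (rule le_SUPE)
    fix k q assume q: "q \<le> ?p" "q \<le> n =\<^sub>B nat_name k"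
    then have F: "q \<le> is_function F n" and rng: "q \<le> (\<Sqinter>z. z \<in>\<^sub>B D \<leftrightarrow>\<^sub>B (\<Squnion>x. maps_to F x z))"
      by (auto simp: is_bijection_def)
    \<comment> \<open>Either \<open>F i\<close> is a number \<open>j\<close>, and \<open>Suc j\<close> is a bound, or it is not a number, and \<open>0\<close> is a bound.\<close>
    have i: "q \<le> (\<Squnion>m. \<Sqinter>j\<in>{m..}. - maps_to F (nat_name i) (nat_name j))" (is "_ \<le> ?R") for i
    proof (rule le_by_cases)
      fix r assume "r \<le> q" "r \<le> (\<Squnion>j. maps_to F (nat_name i) (nat_name j))"
      from this(2) show "r \<le> ?R"
      proof (rule le_SUPE)
        fix j s assume s: "s \<le> r" "s \<le> maps_to F (nat_name i) (nat_name j)"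
        show "s \<le> ?R"
        proof (intro le_SUPI[of "Suc j"] INF_greatest le_uminusI)
          fix j' t assume t: "j' \<in> {Suc j..}" "t \<le> s" "t \<le> maps_to F (nat_name i) (nat_name j')"
          have "t \<le> nat_name j =\<^sub>B nat_name j'"
            by (rule le_is_functionD[OF _ order_trans[OF t(2) s(2)] t(3), of n]) (use F \<open>r \<le> q\<close> s(1) t(2) in auto)
          then show "t \<le> \<bottom>"
            using t(1) by (simp add: nat_name_neq)
        qed simp
      qed
    next
      fix r assume r: "r \<le> - (\<Squnion>j. maps_to F (nat_name i) (nat_name j))"
      show "r \<le> ?R"
      proof (intro le_SUPI[of 0] INF_greatest le_uminusI)
        fix j s assume "s \<le> r" "s \<le> maps_to F (nat_name i) (nat_name j)"
        then show "s \<le> \<bottom>"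
          using order_trans[OF _ r, of s] le_SUPI[OF UNIV_I, of s "\<lambda>j. maps_to F (nat_name i) (nat_name j)" j]
          by - (rule le_uminusD[of s "\<Squnion>j. maps_to F (nat_name i) (nat_name j)"], auto)
      qed simp
    qed
    have "q \<le> (\<Squnion>m. \<Sqinter>j\<in>{m..}. \<Sqinter>i\<in>{..<l}. - maps_to F (nat_name i) (nat_name j))" for l
    proof (induction l)
      case (Suc l)
      show ?case
      proof (rule le_SUPE[OF Suc])
        fix m r assume r: "r \<le> q" "r \<le> (\<Sqinter>j\<in>{m..}. \<Sqinter>i\<in>{..<l}. - maps_to F (nat_name i) (nat_name j))"
        show "r \<le> (\<Squnion>m. \<Sqinter>j\<in>{m..}. \<Sqinter>i\<in>{..<Suc l}. - maps_to F (nat_name i) (nat_name j))"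
        proof (rule le_SUPE[OF order_trans[OF r(1) i[of l]]])
          fix m' s assume "s \<le> r" "s \<le> (\<Sqinter>j\<in>{m'..}. - maps_to F (nat_name l) (nat_name j))"
          then show "s \<le> (\<Squnion>m. \<Sqinter>j\<in>{m..}. \<Sqinter>i\<in>{..<Suc l}. - maps_to F (nat_name i) (nat_name j))"
            using order_trans[OF _ r(2), of s]
            by (intro le_SUPI[of "max m m'"]) (auto simp: le_INF_iff less_Suc_eq)
        qed
      qed
    qed simp
    from this[of k] show "q \<le> bounded D"
    proof (rule le_SUPE)
      fix m r assume r: "r \<le> q" "r \<le> (\<Sqinter>j\<in>{m..}. \<Sqinter>i\<in>{..<k}. - maps_to F (nat_name i) (nat_name j))"
      show "r \<le> bounded D"
        unfolding bounded_def
      proof (intro le_SUPI[of m] INF_greatest le_uminusI)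
        fix j s assume j: "j \<in> {m..}" "s \<le> r" "s \<le> nat_name j \<in>\<^sub>B D"
        note sq = order_trans[OF j(2) r(1)]
        have "s \<le> (\<Squnion>x. maps_to F x (nat_name j))"
          by (rule le_biffD1[OF le_INFD[OF order_trans[OF sq rng] UNIV_I] j(3)])
        then show "s \<le> \<bottom>"
        proof (rule le_SUPE)
          fix x t assume t: "t \<le> s" "t \<le> maps_to F x (nat_name j)"
          have "t \<le> x \<in>\<^sub>B nat_name k"
            using t(1) sq F q(2)
            by (intro le_bmem_subst2[OF le_is_function_dom[OF _ t(2)]]) (auto intro: order_trans)
          then show "t \<le> \<bottom>"
            unfolding bmem_nat_name
          proof (rule le_SUPE)
            fix i u assume u: "i \<in> {..<k}" "u \<le> t" "u \<le> x =\<^sub>B nat_name i"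
            have "u \<le> maps_to F (nat_name i) (nat_name j)"
              by (rule le_maps_to_subst[OF order_trans[OF u(2) t(2)] u(3)]) simp
            moreover have "u \<le> - maps_to F (nat_name i) (nat_name j)"
              using order_trans[OF u(2) order_trans[OF t(1) j(2)]] le_INFD[OF le_INFD[OF r(2) j(1)] u(1)]
              by (rule order_trans)
            ultimately show "u \<le> \<bottom>"
              by (rule le_uminusD[rotated])
          qed
        qed
      qed simp
    qed
  qed
qed

text \<open>
  Below a bound \<open>m\<close>, the cells of the membership values decide \<open>D\<close>. On a single cell \<open>D\<close> is a finite set \<open>X\<close> of the
  ground model, and an enumeration of \<open>X\<close> gives a name for a bijection from a natural number onto \<open>D\<close>.
\<close>

lemma le_is_finiteI:
  fixes D :: "('i, 'b::complete_ba) bname"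
  assumes sub: "p \<le> D \<subseteq>\<^sub>B omega" and bd: "p \<le> bounded D"
  shows "p \<le> is_finite omega D"
  using bd unfolding bounded_def
proof (rule le_SUPE)
  fix m q assume q: "q \<le> p" "q \<le> (\<Sqinter>n\<in>{m..}. - (nat_name n \<in>\<^sub>B D))"
  have "q \<le> (\<Squnion>g. cell (\<lambda>n. nat_name n \<in>\<^sub>B D) g {..<m})"
    by (simp add: SUP_cell_finite)
  then show "q \<le> is_finite omega D"
  proof (rule le_SUPE)
    fix g r assume r: "r \<le> q" "r \<le> cell (\<lambda>n. nat_name n \<in>\<^sub>B D) g {..<m}"
    define X where "X = {n. n < m \<and> g n}"
    have X: "r \<le> nat_name n \<in>\<^sub>B D" if "n \<in> X" for n
      using le_cellD[OF r(2), of n] that by (auto simp: X_def lit_def)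
    have not_X: "r \<le> - (nat_name n \<in>\<^sub>B D)" if "n \<notin> X" for n
      using le_cellD[OF r(2), of n] le_INFD[OF order_trans[OF r(1) q(2)], of n] that
      by (cases "n < m") (auto simp: X_def lit_def)
    have "finite X"
      by (simp add: X_def)
    then obtain h where "bij_betw h {0..<card X} X"
      using ex_bij_betw_nat_finite by blast
    then obtain k where h: "bij_betw h {..<k} X"
      by (auto simp: atLeast0LessThan)
    define F :: "('i, 'b) bname" where "F = nat_family {..<k} (\<lambda>i. (kpair (nat_name i) (nat_name (h i)), \<top>))"
    have F: "elts F = (\<lambda>i. (kpair (nat_name i) (nat_name (h i)), \<top>)) ` {..<k}"
      by (simp add: F_def)
    note m = maps_to_graph[OF F]
    have "r \<le> is_bijection F (nat_name k) D"
      unfolding is_bijection_def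
    proof (intro le_infI INF_greatest le_bimpI le_biffI)
      show "r \<le> is_function F (nat_name k)"
        by (subst is_function_graph[OF F]) (simp_all add: bmem_nat_name nat_name_neq)
    next
      fix x y z s assume "s \<le> maps_to F x z \<sqinter> maps_to F y z"
      then have s: "s \<le> maps_to F x z" "s \<le> maps_to F y z"
        by auto
      from s(1) show "s \<le> x =\<^sub>B y"
        unfolding m
      proof (rule le_SUPE)
        fix i t assume i: "i \<in> {..<k}" "t \<le> s" "t \<le> x =\<^sub>B nat_name i \<sqinter> z =\<^sub>B nat_name (h i)"
        from order_trans[OF i(2) s(2)] show "t \<le> x =\<^sub>B y"
          unfolding m
        proof (rule le_SUPE)
          fix j u assume j: "j \<in> {..<k}" "u \<le> t" "u \<le> y =\<^sub>B nat_name j \<sqinter> z =\<^sub>B nat_name (h j)"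
          have u: "u \<le> x =\<^sub>B nat_name i" "u \<le> z =\<^sub>B nat_name (h i)" "u \<le> y =\<^sub>B nat_name j" "u \<le> z =\<^sub>B nat_name (h j)"
            using i(3) j(2,3) by auto
          show "u \<le> x =\<^sub>B y"
          proof (cases "i = j")
            case True
            then show ?thesis
              using le_beq_trans[OF u(1) le_beq_sym] u(3) by auto
          next
            case False
            then have "h i \<noteq> h j"
              using h i(1) j(1) by (auto simp: bij_betw_def inj_on_def)
            then show ?thesis
              by (rule le_nat_name_inj[OF u(2,4)])
          qed
        qed
      qed
    next
      fix z s assume s: "s \<le> r" "s \<le> z \<in>\<^sub>B D"
      have "s \<le> z \<in>\<^sub>B omega"
        by (rule le_bsubsetD[OF order_trans[OF s(1) order_trans[OF r(1) order_trans[OF q(1) sub]]] s(2)])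
      then show "s \<le> (\<Squnion>x. maps_to F x z)"
        unfolding bmem_omega
      proof (rule le_SUPE)
        fix n t assume t: "t \<le> s" "t \<le> z =\<^sub>B nat_name n"
        have n: "t \<le> nat_name n \<in>\<^sub>B D"
          by (rule le_bmem_subst1[OF order_trans[OF t(1) s(2)] t(2)])
        show "t \<le> (\<Squnion>x. maps_to F x z)"
        proof (cases "n \<in> X")
          case True
          then obtain i where i: "i < k" "n = h i"
            using h by (auto simp: bij_betw_def)
          show ?thesis
            unfolding m using i t(2) by (intro le_SUPI[of "nat_name i"] le_SUPI[of i]) auto
        next
          case False
          have "t \<le> - (nat_name n \<in>\<^sub>B D)"
            using not_X[OF False] t(1) s(1) by (auto intro: order_trans)
          then show ?thesis
            using n by (rule le_uminusD)
        qed
      qed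
    next
      fix z s assume s: "s \<le> r" "s \<le> (\<Squnion>x. maps_to F x z)"
      from s(2) show "s \<le> z \<in>\<^sub>B D"
        unfolding m
      proof (elim le_SUPE)
        fix i u t x assume t: "i \<in> {..<k}" "t \<le> s" "u \<le> t" "u \<le> x =\<^sub>B nat_name i \<sqinter> z =\<^sub>B nat_name (h i)"
        have "u \<le> nat_name (h i) \<in>\<^sub>B D"
          using X[of "h i"] h t s(1) by (auto simp: bij_betw_def intro: order_trans)
        then show "u \<le> z \<in>\<^sub>B D"
          using t(4) by (intro le_bmem_subst1[OF _ le_beq_sym[of u z]]) auto
      qed
    qed
    then show "r \<le> is_finite omega D"
      unfolding is_finite_def by (intro le_SUPI[of "nat_name k"] le_SUPI[of F]) auto
  qed
qed

lemma is_inf_subset_omega: "is_inf_subset omega S = S \<subseteq>\<^sub>B omega \<sqinter> - bounded S"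
proof (rule antisym)
  show "is_inf_subset omega S \<le> S \<subseteq>\<^sub>B omega \<sqinter> - bounded S"
    unfolding is_inf_subset_def
  proof (intro le_infI le_uminusI)
    fix q assume "q \<le> S \<subseteq>\<^sub>B omega \<sqinter> - is_finite omega S" "q \<le> bounded S"
    then show "q \<le> \<bottom>"
      using le_is_finiteI[of q S] by - (rule le_uminusD[of q "is_finite omega S"], auto)
  qed simp
  show "S \<subseteq>\<^sub>B omega \<sqinter> - bounded S \<le> is_inf_subset omega S"
    unfolding is_inf_subset_def by (rule inf_mono[OF order_refl compl_mono[OF is_finite_le_bounded]])
qed

lemma almost_subset_le:
  "almost_subset omega S T \<le> almost_le (\<lambda>n. nat_name n \<in>\<^sub>B S) (\<lambda>n. nat_name n \<in>\<^sub>B T)"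
  unfolding almost_subset_def
proof (rule SUP_least)
  fix D
  let ?p = "(\<Sqinter>z. z \<in>\<^sub>B D \<leftrightarrow>\<^sub>B z \<in>\<^sub>B S \<sqinter> - (z \<in>\<^sub>B T)) \<sqinter> is_finite omega D"
  have D: "?p \<le> z \<in>\<^sub>B D \<leftrightarrow>\<^sub>B z \<in>\<^sub>B S \<sqinter> - (z \<in>\<^sub>B T)" for z
    by (rule le_infI1) (rule INF_lower[OF UNIV_I])
  have "?p \<le> bounded D"
    by (rule le_infI2) (rule is_finite_le_bounded)
  then show "?p \<le> almost_le (\<lambda>n. nat_name n \<in>\<^sub>B S) (\<lambda>n. nat_name n \<in>\<^sub>B T)"
    unfolding bounded_def
  proof (rule le_SUPE)
    fix m q assume q: "q \<le> ?p" "q \<le> (\<Sqinter>n\<in>{m..}. - (nat_name n \<in>\<^sub>B D))"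
    show "q \<le> almost_le (\<lambda>n. nat_name n \<in>\<^sub>B S) (\<lambda>n. nat_name n \<in>\<^sub>B T)"
      unfolding almost_le_def
    proof (intro le_SUPI[of m] INF_greatest le_bimpI)
      fix n r assume n: "n \<in> {m..}" "r \<le> q" "r \<le> nat_name n \<in>\<^sub>B S"
      show "r \<le> nat_name n \<in>\<^sub>B T"
      proof (rule le_by_cases[of r "nat_name n \<in>\<^sub>B T"])
        fix s assume s: "s \<le> r" "s \<le> - (nat_name n \<in>\<^sub>B T)"
        have "s \<le> nat_name n \<in>\<^sub>B D"
          by (rule le_biffD2[OF order_trans[OF order_trans[OF s(1) order_trans[OF n(2) q(1)]] D]])
            (use s n(3) in auto)
        moreover have "s \<le> - (nat_name n \<in>\<^sub>B D)"
          using n s(1) q(2) by (auto simp: le_INF_iff intro: order_trans)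
        ultimately show "s \<le> nat_name n \<in>\<^sub>B T"
          by (rule le_uminusD[rotated])
      qed
    qed simp
  qed
qed

text \<open>
  The difference set that \<open>almost_subset\<close> asks for is given by an explicit name \<open>D\<close>, and the bound supplied by
  \<open>almost_le\<close> is a bound for \<open>D\<close>.
\<close>

lemma le_almost_subsetI:
  fixes S :: "('i, 'b::complete_ba) bname"
  assumes "p \<le> S \<subseteq>\<^sub>B omega" "p \<le> almost_le (\<lambda>n. nat_name n \<in>\<^sub>B S) (\<lambda>n. nat_name n \<in>\<^sub>B T)"
  shows "p \<le> almost_subset omega S T"
proof -
  define D where "D = nat_family UNIV (\<lambda>n. (nat_name n, nat_name n \<in>\<^sub>B S \<sqinter> - (nat_name n \<in>\<^sub>B T)))"
  have D: "z \<in>\<^sub>B D = (\<Squnion>n. z =\<^sub>B nat_name n \<sqinter> (nat_name n \<in>\<^sub>B S \<sqinter> - (nat_name n \<in>\<^sub>B T)))" for z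
    by (simp add: D_def bmem_nat_family)
  have "q \<le> z \<in>\<^sub>B S \<sqinter> - (z \<in>\<^sub>B T) \<sqinter> z \<in>\<^sub>B omega" if "q \<le> z \<in>\<^sub>B D" for q z
    using that unfolding D
  proof (rule le_SUPE)
    fix n r assume "r \<le> z =\<^sub>B nat_name n \<sqinter> (nat_name n \<in>\<^sub>B S \<sqinter> - (nat_name n \<in>\<^sub>B T))"
    then have r: "r \<le> nat_name n =\<^sub>B z" "r \<le> nat_name n \<in>\<^sub>B S" "r \<le> - (nat_name n \<in>\<^sub>B T)"
      by (auto intro: le_beq_sym)
    then show "r \<le> z \<in>\<^sub>B S \<sqinter> - (z \<in>\<^sub>B T) \<sqinter> z \<in>\<^sub>B omega"
      using le_bmem_subst1[OF r(2,1)] le_not_bmem_subst1[OF r(3,1)] le_bmem_subst1[OF _ r(1), of omega]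
      by auto
  qed
  then have D1: "q \<le> z \<in>\<^sub>B S" "q \<le> - (z \<in>\<^sub>B T)" "q \<le> z \<in>\<^sub>B omega" if "q \<le> z \<in>\<^sub>B D" for q z
    using that by auto
  have "q \<le> z \<in>\<^sub>B D" if "q \<le> p" "q \<le> z \<in>\<^sub>B S" "q \<le> - (z \<in>\<^sub>B T)" for q z
  proof -
    have "q \<le> z \<in>\<^sub>B omega"
      by (rule le_bsubsetD[OF order_trans[OF that(1) assms(1)] that(2)])
    then show ?thesis
      unfolding bmem_omega
    proof (rule le_SUPE)
      fix n r assume r: "r \<le> q" "r \<le> z =\<^sub>B nat_name n"
      have "r \<le> nat_name n \<in>\<^sub>B S"
        by (rule le_bmem_subst1[OF order_trans[OF r(1) that(2)] r(2)])
      moreover have "r \<le> - (nat_name n \<in>\<^sub>B T)"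
        by (rule le_not_bmem_subst1[OF order_trans[OF r(1) that(3)] r(2)])
      ultimately show "r \<le> z \<in>\<^sub>B D"
        unfolding D using r(2) by (intro le_SUPI[of n]) auto
    qed
  qed
  then have "p \<le> (\<Sqinter>z. z \<in>\<^sub>B D \<leftrightarrow>\<^sub>B z \<in>\<^sub>B S \<sqinter> - (z \<in>\<^sub>B T))"
    by (intro INF_greatest le_biffI) (auto intro: D1)
  moreover have "p \<le> bounded D"
    using assms(2) unfolding almost_le_def
  proof (rule le_SUPE)
    fix m q assume q: "q \<le> (\<Sqinter>n\<in>{m..}. nat_name n \<in>\<^sub>B S \<rightarrow>\<^sub>B nat_name n \<in>\<^sub>B T)"
    show "q \<le> bounded D"
      unfolding bounded_def
    proof (intro le_SUPI[of m] INF_greatest le_uminusI)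
      fix n r assume r: "n \<in> {m..}" "r \<le> q" "r \<le> nat_name n \<in>\<^sub>B D"
      have "r \<le> nat_name n \<in>\<^sub>B T"
        by (rule le_bimpD[OF le_INFD[OF order_trans[OF r(2) q] r(1)] D1(1)[OF r(3)]])
      with D1(2)[OF r(3)] show "r \<le> \<bottom>"
        by (rule le_uminusD)
    qed simp
  qed
  then have "p \<le> is_finite omega D"
    by (intro le_is_finiteI) (auto simp: bsubset_def intro!: INF_greatest le_bimpI D1)
  ultimately show ?thesis
    unfolding almost_subset_def by (intro le_SUPI[of D]) auto
qed

end

section \<open>Ordinals below the tower number\<close>

text \<open>
  A common form for \<open>check r\<close> and \<open>check_below r a\<close>, so that an induction over initial segments of \<open>r\<close> can end with
  \<open>r\<close> itself.
\<close>

definition check_set :: "'i rel \<Rightarrow> 'i set \<Rightarrow> ('i, 'b::complete_ba) bname" where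
  "check_set r A = family A (\<lambda>a. (check_below r a, \<top>))"

lemma check_eq_check_set: "check r = check_set r (Field r)"
  by (simp add: check_def check_set_def family_def)

lemma check_below_eq_check_set: "Well_order r \<Longrightarrow> check_below r a = check_set r (underS r a)"
  by (subst check_below) (simp_all add: check_set_def family_def)

lemma elts_check_set: "elts (check_set r A) = (\<lambda>a. (check_below r a, \<top>)) ` A"
  by (simp add: check_set_def)

lemma bmem_check_set: "z \<in>\<^sub>B check_set r A = (\<Squnion>a\<in>A. z =\<^sub>B check_below r a)"
  by (simp add: bmem_def elts_check_set image_comp)

lemma check_set_neq_below:
  assumes "Well_order r" "a \<in> A"
  shows "(check_set r A :: ('i, 'b::complete_ba) bname) =\<^sub>B check_below r a = \<bottom>"
  by (rule elts_imp_beq_bot) (use assms in \<open>simp add: elts_check_set\<close>)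

text \<open>
  One of the two names is an element of the other, so equality would contradict foundation.
\<close>

lemma check_below_inj:
  assumes "Well_order r" "a \<in> Field r" "b \<in> Field r" "a \<noteq> b"
  shows "(check_below r a :: ('i, 'b::complete_ba) bname) =\<^sub>B check_below r b = \<bottom>"
proof -
  have "a \<in> underS r b \<or> b \<in> underS r a"
    using assms unfolding well_order_on_def linear_order_on_def total_on_def underS_def by blast
  then show ?thesis
    using check_set_neq_below[OF assms(1), of a "underS r b", where 'b = 'b]
      check_set_neq_below[OF assms(1), of b "underS r a", where 'b = 'b]
    by (auto simp: check_below_eq_check_set[OF assms(1), symmetric] beq_sym)
qed

lemma le_is_transitiveD:
  "p \<le> is_transitive x \<Longrightarrow> p \<le> y \<in>\<^sub>B x \<Longrightarrow> p \<le> z \<in>\<^sub>B y \<Longrightarrow> p \<le> z \<in>\<^sub>B x"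
  unfolding is_transitive_def
  by (drule le_INFD[OF _ UNIV_I], drule le_bimpD, assumption) (rule le_bsubsetD)

lemma is_transitive_check_set:
  assumes "Well_order r" "wo_rel.ofilter r A"
  shows "p \<le> is_transitive (check_set r A)"
  unfolding is_transitive_def bsubset_def
proof (intro INF_greatest le_bimpI)
  fix y z q q' assume q: "q \<le> y \<in>\<^sub>B check_set r A" "q' \<le> q" "q' \<le> z \<in>\<^sub>B y"
  from order_trans[OF q(2,1)] show "q' \<le> z \<in>\<^sub>B check_set r A"
    unfolding bmem_check_set[of y]
  proof (rule le_SUPE)
    fix a s assume s: "a \<in> A" "s \<le> q'" "s \<le> y =\<^sub>B check_below r a"
    have "s \<le> z \<in>\<^sub>B check_set r (underS r a)"
      using le_bmem_subst2[OF order_trans[OF s(2) q(3)] s(3)]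
      by (simp add: check_below_eq_check_set[OF assms(1)])
    also have "\<dots> \<le> z \<in>\<^sub>B check_set r A"
      unfolding bmem_check_set using assms s(1)
      by (intro SUP_subset_mono) (auto simp: wo_rel.ofilter_def wo_rel_def underS_def under_def)
    finally show "s \<le> z \<in>\<^sub>B check_set r A" .
  qed
qed

lemma is_ordinal_check_set:
  fixes p :: "'b::complete_ba" and r :: "'i rel"
  assumes "Well_order r" "wo_rel.ofilter r A"
  shows "p \<le> is_ordinal (check_set r A :: ('i, 'b) bname)"
  unfolding is_ordinal_def
proof (intro le_infI is_transitive_check_set assms INF_greatest le_bimpI)
  fix y :: "('i, 'b) bname" and q assume "q \<le> y \<in>\<^sub>B check_set r A"
  then show "q \<le> is_transitive y"
    unfolding bmem_check_set
  proof (rule le_SUPE)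
    fix a s assume s: "s \<le> y =\<^sub>B check_below r a"
    have tr: "s' \<le> is_transitive (check_below r a :: ('i, 'b) bname)" for s'
      unfolding check_below_eq_check_set[OF assms(1)]
      using assms(1) by (intro is_transitive_check_set) (simp_all add: wo_rel.underS_ofilter wo_rel_def)
    show "s \<le> is_transitive y"
      unfolding is_transitive_def bsubset_def
    proof (intro INF_greatest le_bimpI)
      fix u z q q' assume q: "q \<le> s" "q \<le> u \<in>\<^sub>B y" "q' \<le> q" "q' \<le> z \<in>\<^sub>B u"
      have eq: "q' \<le> y =\<^sub>B check_below r a"
        using q(1,3) s by auto
      have "q' \<le> u \<in>\<^sub>B check_below r a"
        by (rule le_bmem_subst2[OF order_trans[OF q(3,2)] eq])
      from le_is_transitiveD[OF tr this q(4)] show "q' \<le> z \<in>\<^sub>B y"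
        by (rule le_bmem_subst2[OF _ le_beq_sym[OF eq]])
    qed
  qed
qed

lemma le_is_function_subst:
  assumes "p \<le> is_function F d" and d: "p \<le> d =\<^sub>B d'"
  shows "p \<le> is_function F d'"
proof -
  have F: "p \<le> z \<in>\<^sub>B F \<rightarrow>\<^sub>B (\<Squnion>x. \<Squnion>y. x \<in>\<^sub>B d \<sqinter> is_pair z x y)"
    "p \<le> x \<in>\<^sub>B d \<rightarrow>\<^sub>B (\<Squnion>y. maps_to F x y)"
    "p \<le> maps_to F x y \<sqinter> maps_to F x z \<rightarrow>\<^sub>B y =\<^sub>B z" for x y z
    using assms(1) unfolding is_function_def by (auto simp: le_INF_iff)
  show ?thesis
    unfolding is_function_def
  proof (intro le_infI INF_greatest)
    fix x y z
    show "p \<le> maps_to F x y \<sqinter> maps_to F x z \<rightarrow>\<^sub>B y =\<^sub>B z"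
      by (rule F(3))
  next
    fix z
    show "p \<le> z \<in>\<^sub>B F \<rightarrow>\<^sub>B (\<Squnion>x. \<Squnion>y. x \<in>\<^sub>B d' \<sqinter> is_pair z x y)"
    proof (rule le_bimpI)
      fix q assume q: "q \<le> p" "q \<le> z \<in>\<^sub>B F"
      from le_bimpD[OF order_trans[OF q(1) F(1)] q(2)]
      show "q \<le> (\<Squnion>x. \<Squnion>y. x \<in>\<^sub>B d' \<sqinter> is_pair z x y)"
      proof (elim le_SUPE)
        fix x y s t assume t: "s \<le> q" "t \<le> s" "t \<le> x \<in>\<^sub>B d \<sqinter> is_pair z x y"
        then have "t \<le> x \<in>\<^sub>B d'"
          using q(1) d by (intro le_bmem_subst2[of t x d d']) auto
        with t(3) have "t \<le> x \<in>\<^sub>B d' \<sqinter> is_pair z x y"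
          by simp
        then show "t \<le> (\<Squnion>x. \<Squnion>y. x \<in>\<^sub>B d' \<sqinter> is_pair z x y)"
          by - (rule le_SUPI[OF UNIV_I, of _ _ x], rule le_SUPI[OF UNIV_I, of _ _ y])
      qed
    qed
  next
    fix x
    show "p \<le> x \<in>\<^sub>B d' \<rightarrow>\<^sub>B (\<Squnion>y. maps_to F x y)"
    proof (rule le_bimpI)
      fix q assume q: "q \<le> p" "q \<le> x \<in>\<^sub>B d'"
      have "q \<le> x \<in>\<^sub>B d"
        by (rule le_bmem_subst2[OF q(2) le_beq_sym[OF order_trans[OF q(1) d]]])
      then show "q \<le> (\<Squnion>y. maps_to F x y)"
        by (rule le_bimpD[OF order_trans[OF q(1) F(2)]])
    qed
  qed
qed

lemma le_is_tower_subst: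
  assumes "p \<le> is_tower w d F" and d: "p \<le> d =\<^sub>B d'"
  shows "p \<le> is_tower w d' F"
proof -
  have T: "p \<le> is_function F d"
    "p \<le> (\<Sqinter>x. \<Sqinter>S. maps_to F x S \<rightarrow>\<^sub>B is_inf_subset w S)"
    "p \<le> x \<in>\<^sub>B y \<sqinter> y \<in>\<^sub>B d \<sqinter> maps_to F x S \<sqinter> maps_to F y T \<rightarrow>\<^sub>B almost_subset w T S"
    "p \<le> - (\<Squnion>S. is_inf_subset w S \<sqinter> (\<Sqinter>x. \<Sqinter>T. maps_to F x T \<rightarrow>\<^sub>B almost_subset w S T))"
    for x y S T
    using assms(1) unfolding is_tower_def by (auto simp: le_INF_iff)
  show ?thesis
    unfolding is_tower_def
  proof (intro le_infI T(2,4) le_is_function_subst[OF T(1) d]; intro INF_greatest le_bimpI)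
    fix x y S T q
    assume q: "q \<le> p" "q \<le> x \<in>\<^sub>B y \<sqinter> y \<in>\<^sub>B d' \<sqinter> maps_to F x S \<sqinter> maps_to F y T"
    then have "q \<le> y \<in>\<^sub>B d"
      by (intro le_bmem_subst2[OF _ le_beq_sym[OF order_trans[OF q(1) d]]]) auto
    with q show "q \<le> almost_subset w T S"
      by (intro le_bimpD[OF order_trans[OF q(1) T(3)[of x y S T]]]) auto
  qed
qed

context nat_index
begin

text \<open>
  Let \<open>c\<close> be the value of the statement that \<open>F\<close> is a tower of length \<open>A\<close>. As no element of \<open>A\<close> is the length of a
  tower, \<open>c\<close> forces \<open>A\<close> to be the tower number. By hypothesis \<open>c\<close> forces \<open>r\<close> to be an element of \<open>A\<close>, that is, equal
  to some \<open>a \<in> A\<close>; but \<open>a\<close> is an element of \<open>r\<close>.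
\<close>

lemma no_tower_step:
  fixes r :: "'i rel"
  assumes r: "Well_order r" "wo_rel.ofilter r A"
    and less: "less_tower_number r = (\<top> :: 'b::complete_ba)"
    and IH: "\<And>a F. a \<in> A \<Longrightarrow> is_tower omega (check_below r a) F = (\<bottom> :: 'b)"
  shows "is_tower omega (check_set r A) F = (\<bottom> :: 'b)"
proof -
  let ?c = "is_tower omega (check_set r A) F"
  let ?l = "(\<Sqinter>w :: ('i, 'b) bname. \<Sqinter>t. is_omega w \<sqinter> is_tower_number w t \<rightarrow>\<^sub>B check r \<in>\<^sub>B t)"
  have "?c \<le> ?l"
    using less unfolding less_tower_number_def by simp
  then have "?c \<le> is_omega omega \<sqinter> is_tower_number omega (check_set r A) \<rightarrow>\<^sub>B check r \<in>\<^sub>B check_set r A"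
    unfolding le_INF_iff by blast
  moreover have "?c \<le> is_omega omega \<sqinter> is_tower_number omega (check_set r A)"
    unfolding is_tower_number_def
  proof (intro le_infI is_ordinal_check_set r INF_greatest le_bimpI le_uminusI)
    show "?c \<le> (\<Squnion>F. is_tower omega (check_set r A) F)"
      by (rule le_SUPI[of F]) simp_all
  next
    fix d :: "('i, 'b) bname" and q q' assume q: "q \<le> d \<in>\<^sub>B check_set r A" "q' \<le> q" "q' \<le> (\<Squnion>F. is_tower omega d F)"
    from order_trans[OF q(2,1)] show "q' \<le> \<bottom>"
      unfolding bmem_check_set
    proof (rule le_SUPE)
      fix a s assume s: "a \<in> A" "s \<le> q'" "s \<le> d =\<^sub>B check_below r a"
      show "s \<le> \<bottom>"
      proof (rule le_SUPE[OF order_trans[OF s(2) q(3)]])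
        fix F t assume t: "t \<le> s" "t \<le> is_tower omega d F"
        show "t \<le> \<bottom>"
          using le_is_tower_subst[OF t(2) order_trans[OF t(1) s(3)]] unfolding IH[OF s(1)] .
      qed
    qed
  qed (simp add: is_omega_omega)
  ultimately have "?c \<le> check r \<in>\<^sub>B check_set r A"
    by (rule le_bimpD)
  then have "?c \<le> \<bottom>"
    unfolding bmem_check_set
  proof (rule le_SUPE)
    fix a q assume "a \<in> A" "q \<le> check r =\<^sub>B check_below r a"
    moreover have "a \<in> Field r"
      using \<open>a \<in> A\<close> r by (auto simp: wo_rel.ofilter_def wo_rel_def)
    ultimately show "q \<le> \<bottom>"
      unfolding check_eq_check_set by (simp add: check_set_neq_below r)
  qed
  then show ?thesis
    by (simp add: bot.extremum_unique)
qed

lemma no_tower: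
  fixes r :: "'i rel"
  assumes r: "Well_order r" "wo_rel.ofilter r A"
    and less: "less_tower_number r = (\<top> :: 'b::complete_ba)"
  shows "is_tower omega (check_set r A) F = (\<bottom> :: 'b)"
proof (rule no_tower_step[OF r less])
  fix a F
  have "wf (r - Id)"
    using r(1) by (simp add: well_order_on_def)
  then show "is_tower omega (check_below r a) F = (\<bottom> :: 'b)"
  proof (induction a arbitrary: F rule: wf_induct_rule)
    case (less a)
    then show ?case
      unfolding check_below_eq_check_set[OF r(1), of a] using r(1) assms(3)
      by (intro no_tower_step wo_rel.underS_ofilter) (auto simp: wo_rel_def underS_def)
  qed
qed

text \<open>
  What it means for \<open>r\<close> to be below the tower number when there are no new sets of natural numbers: an almost
  decreasing sequence of infinite sets in the extension, of length at most \<open>r\<close>, has a pseudo-intersection, and this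
  can be found in the ground model on each piece of a partition. The sequence is turned into a name \<open>F\<close>, which by
  \<open>no_tower\<close> fails to be a tower; as it has all other properties of a tower, a pseudo-intersection \<open>T\<close> exists in the
  extension, and the cells of its membership values decide \<open>T\<close>.
\<close>

lemma pseudo_intersection:
  fixes r :: "'i rel" and s :: "'i \<Rightarrow> nat \<Rightarrow> 'b::complete_ba"
  assumes r: "Well_order r" "wo_rel.ofilter r A"
    and less: "less_tower_number r = (\<top> :: 'b::complete_ba)"
    and distr: "\<And>t :: nat \<Rightarrow> 'b. (\<Squnion>g. cell t g UNIV) = \<top>"
    and inf: "\<And>a. a \<in> A \<Longrightarrow> (\<Squnion>m. \<Sqinter>n\<in>{m..}. - s a n) = \<bottom>"
    and dec: "\<And>a b. b \<in> A \<Longrightarrow> a \<in> underS r b \<Longrightarrow> almost_le (s b) (s a) = \<top>"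
  shows "(\<Squnion>X\<in>{X. infinite X}. \<Sqinter>a\<in>A. almost_le (\<lambda>n. lit \<top> (n \<in> X)) (s a)) = \<top>"
proof -
  define S where "S a = nat_family UNIV (\<lambda>n. (nat_name n, s a n))" for a
  have S: "z \<in>\<^sub>B S a = (\<Squnion>n. z =\<^sub>B nat_name n \<sqinter> s a n)" for z a
    by (simp add: S_def bmem_nat_family)
  have mem_S: "nat_name n \<in>\<^sub>B S a = s a n" for n a
  proof (rule antisym)
    show "nat_name n \<in>\<^sub>B S a \<le> s a n"
      unfolding S
    proof (rule SUP_least)
      fix k show "nat_name n =\<^sub>B nat_name k \<sqinter> s a k \<le> s a n"
        by (cases "n = k") (simp_all add: nat_name_neq)
    qed
    show "s a n \<le> nat_name n \<in>\<^sub>B S a"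
      unfolding S by (rule le_SUPI[of n]) simp_all
  qed
  \<comment> \<open>A value of \<open>F\<close> is in general only forced to be equal to some \<open>S a\<close>.\<close>
  have mem_S': "q \<le> nat_name n \<in>\<^sub>B T \<longleftrightarrow> q \<le> s a n" if "q \<le> T =\<^sub>B S a" for q T n a
    using le_bmem_subst2[OF _ that, of "nat_name n"] le_bmem_subst2[OF _ le_beq_sym[OF that], of "nat_name n"]
    unfolding mem_S by blast
  have sub: "q \<le> T \<subseteq>\<^sub>B omega" if T: "q \<le> T =\<^sub>B S a" for q T a
    unfolding bsubset_def
  proof (intro INF_greatest le_bimpI)
    fix z q' assume q': "q' \<le> q" "q' \<le> z \<in>\<^sub>B T"
    have "q' \<le> z \<in>\<^sub>B S a"
      by (rule le_bmem_subst2[OF q'(2) order_trans[OF q'(1) T]])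
    also have "\<dots> \<le> z \<in>\<^sub>B omega"
      unfolding S bmem_omega by (rule SUP_subset_mono) simp_all
    finally show "q' \<le> z \<in>\<^sub>B omega" .
  qed
  define F where "F = family A (\<lambda>a. (kpair (check_below r a) (S a), \<top>))"
  have F: "elts F = (\<lambda>a. (kpair (check_below r a) (S a), \<top>)) ` A"
    by (simp add: F_def)
  note m = maps_to_graph[OF F]
  have A: "A \<subseteq> Field r"
    using r by (simp add: wo_rel.ofilter_def wo_rel_def)
  have func: "is_function F (check_set r A) = \<top>"
    using A by (intro is_function_graph[OF F] check_below_inj r(1)) (auto simp: bmem_check_set)
  have inf_subset: "\<top> \<le> (\<Sqinter>x. \<Sqinter>T. maps_to F x T \<rightarrow>\<^sub>B is_inf_subset omega T)"
  proof (intro INF_greatest le_bimpI)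
    fix x T q assume "q \<le> maps_to F x T"
    then show "q \<le> is_inf_subset omega T"
      unfolding m
    proof (rule le_SUPE)
      fix a q assume a: "a \<in> A" "q \<le> x =\<^sub>B check_below r a \<sqinter> T =\<^sub>B S a"
      then have T: "q \<le> T =\<^sub>B S a"
        by simp
      show "q \<le> is_inf_subset omega T"
        unfolding is_inf_subset_omega
      proof (intro le_infI sub[OF T] le_uminusI)
        fix q1 assume q1: "q1 \<le> q" "q1 \<le> bounded T"
        have "q1 \<le> (\<Squnion>m. \<Sqinter>n\<in>{m..}. - s a n)"
        proof (rule le_SUPE[OF q1(2)[unfolded bounded_def]])
          fix k q2 assume q2: "q2 \<le> q1" "q2 \<le> (\<Sqinter>n\<in>{k..}. - (nat_name n \<in>\<^sub>B T))"
          show "q2 \<le> (\<Squnion>m. \<Sqinter>n\<in>{m..}. - s a n)"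
          proof (intro le_SUPI[of k] INF_greatest le_uminusI)
            fix n q3 assume n: "n \<in> {k..}" and q3: "q3 \<le> q2" "q3 \<le> s a n"
            have "q3 \<le> nat_name n \<in>\<^sub>B T"
              using mem_S'[of q3 T a n] q1 q2 q3 T by auto
            then show "q3 \<le> \<bottom>"
              by (rule le_uminusD[OF order_trans[OF q3(1) le_INFD[OF q2(2) n]]])
          qed simp
        qed
        then show "q1 \<le> \<bottom>"
          by (simp add: inf a(1))
      qed
    qed
  qed
  have "\<top> \<le> (\<Sqinter>x. \<Sqinter>y. \<Sqinter>T. \<Sqinter>U. x \<in>\<^sub>B y \<sqinter> y \<in>\<^sub>B check_set r A \<sqinter> maps_to F x T \<sqinter> maps_to F y U
        \<rightarrow>\<^sub>B almost_subset omega U T)"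
  proof (intro INF_greatest le_bimpI)
    fix x y T U q
    assume "q \<le> x \<in>\<^sub>B y \<sqinter> y \<in>\<^sub>B check_set r A \<sqinter> maps_to F x T \<sqinter> maps_to F y U"
    then have q: "q \<le> x \<in>\<^sub>B y" "q \<le> maps_to F x T" "q \<le> maps_to F y U"
      by auto
    show "q \<le> almost_subset omega U T"
    proof (rule le_SUPE[OF q(2)[unfolded m]])
      fix a q1 assume a: "a \<in> A" and q1: "q1 \<le> q" "q1 \<le> x =\<^sub>B check_below r a \<sqinter> T =\<^sub>B S a"
      show "q1 \<le> almost_subset omega U T"
      proof (rule le_SUPE[OF order_trans[OF q1(1) q(3)[unfolded m]]])
        fix b q2 assume b: "b \<in> A" and q2: "q2 \<le> q1" "q2 \<le> y =\<^sub>B check_below r b \<sqinter> U =\<^sub>B S b"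
        have x: "q2 \<le> x =\<^sub>B check_below r a" and T: "q2 \<le> T =\<^sub>B S a"
          and y: "q2 \<le> y =\<^sub>B check_below r b" and U: "q2 \<le> U =\<^sub>B S b"
          using q1 q2 by auto
        have "q2 \<le> x \<in>\<^sub>B y"
          using q(1) q1(1) q2(1) by auto
        then have "q2 \<le> check_below r a \<in>\<^sub>B check_below r b"
          by (rule le_bmem_subst1[OF le_bmem_subst2[OF _ y] x])
        then have ab: "q2 \<le> (\<Squnion>c\<in>underS r b. check_below r a =\<^sub>B check_below r c)"
          by (simp add: check_below_eq_check_set[OF r(1), of b] bmem_check_set)
        show "q2 \<le> almost_subset omega U T"
        proof (cases "a \<in> underS r b")
          case True
          have "q2 \<le> almost_le (s b) (s a)"
            by (simp add: dec[OF b True])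
          then have "q2 \<le> almost_le (\<lambda>n. nat_name n \<in>\<^sub>B U) (\<lambda>n. nat_name n \<in>\<^sub>B T)"
            unfolding almost_le_def
          proof (rule le_SUPE)
            fix k q3 assume q3: "q3 \<le> q2" "q3 \<le> (\<Sqinter>n\<in>{k..}. s b n \<rightarrow>\<^sub>B s a n)"
            show "q3 \<le> (\<Squnion>m. \<Sqinter>n\<in>{m..}. nat_name n \<in>\<^sub>B U \<rightarrow>\<^sub>B nat_name n \<in>\<^sub>B T)"
            proof (intro le_SUPI[of k] INF_greatest le_bimpI)
              fix n q4 assume n: "n \<in> {k..}" and q4: "q4 \<le> q3" "q4 \<le> nat_name n \<in>\<^sub>B U"
              have "q4 \<le> s b n \<rightarrow>\<^sub>B s a n"
                by (rule order_trans[OF q4(1) le_INFD[OF q3(2) n]])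
              then show "q4 \<le> nat_name n \<in>\<^sub>B T"
                using mem_S'[of q4 U b n] mem_S'[of q4 T a n] le_bimpD[of q4 "s b n" "s a n"] T U q3(1) q4
                by auto
            qed simp
          qed
          with sub[OF U] show ?thesis
            by (rule le_almost_subsetI)
        next
          case False
          have "check_below r a =\<^sub>B check_below r c = (\<bottom> :: 'b)" if "c \<in> underS r b" for c
            using False that a A r(1) by (intro check_below_inj) (auto simp: underS_def Field_def)
          then have "q2 \<le> \<bottom>"
            using ab by simp
          then show ?thesis
            by (simp add: bot.extremum_unique)
        qed
      qed
    qed
  qed
  then have "- is_tower omega (check_set r A) F
      = (\<Squnion>T. is_inf_subset omega T \<sqinter> (\<Sqinter>x. \<Sqinter>U. maps_to F x U \<rightarrow>\<^sub>B almost_subset omega T U))"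
    using inf_subset by (simp add: is_tower_def func top.extremum_unique)
  then have "\<top> \<le> (\<Squnion>T. is_inf_subset omega T \<sqinter> (\<Sqinter>x. \<Sqinter>U. maps_to F x U \<rightarrow>\<^sub>B almost_subset omega T U))"
    by (simp add: no_tower[OF r less])
  then have "\<top> \<le> (\<Squnion>X\<in>{X. infinite X}. \<Sqinter>a\<in>A. almost_le (\<lambda>n. lit \<top> (n \<in> X)) (s a))"
  proof (rule le_SUPE)
    fix T p
    assume "p \<le> is_inf_subset omega T \<sqinter> (\<Sqinter>x. \<Sqinter>U. maps_to F x U \<rightarrow>\<^sub>B almost_subset omega T U)"
    then have T: "p \<le> - bounded T" and ps: "p \<le> maps_to F x U \<rightarrow>\<^sub>B almost_subset omega T U" for x U
      by (auto simp: is_inf_subset_omega le_INF_iff)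
    have le: "p \<le> almost_le (\<lambda>n. nat_name n \<in>\<^sub>B T) (s a)" if "a \<in> A" for a
    proof -
      have "p \<le> maps_to F (check_below r a) (S a)"
        unfolding m by (rule le_SUPI[OF that]) simp
      from le_bimpD[OF ps this] have "p \<le> almost_subset omega T (S a)" .
      also have "\<dots> \<le> almost_le (\<lambda>n. nat_name n \<in>\<^sub>B T) (s a)"
        using almost_subset_le[of T "S a"] by (simp add: mem_S)
      finally show ?thesis .
    qed
    have "p \<le> (\<Squnion>g. cell (\<lambda>n. nat_name n \<in>\<^sub>B T) g UNIV)"
      by (simp add: distr)
    then show "p \<le> (\<Squnion>X\<in>{X. infinite X}. \<Sqinter>a\<in>A. almost_le (\<lambda>n. lit \<top> (n \<in> X)) (s a))"
    proof (rule le_SUPE)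
      fix g q assume q: "q \<le> p" "q \<le> cell (\<lambda>n. nat_name n \<in>\<^sub>B T) g UNIV"
      show "q \<le> (\<Squnion>X\<in>{X. infinite X}. \<Sqinter>a\<in>A. almost_le (\<lambda>n. lit \<top> (n \<in> X)) (s a))"
      proof (cases "infinite {n. g n}")
        case True
        show ?thesis
        proof (rule le_SUPI[of "{n. g n}"], simp add: True, rule INF_greatest)
          fix a assume "a \<in> A"
          from order_trans[OF q(1) le[OF this]]
          show "q \<le> almost_le (\<lambda>n. lit \<top> (n \<in> {n. g n})) (s a)"
            unfolding almost_le_def
          proof (rule le_SUPE)
            fix k q1 assume q1: "q1 \<le> q" "q1 \<le> (\<Sqinter>n\<in>{k..}. nat_name n \<in>\<^sub>B T \<rightarrow>\<^sub>B s a n)"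
            show "q1 \<le> (\<Squnion>m. \<Sqinter>n\<in>{m..}. lit \<top> (n \<in> {n. g n}) \<rightarrow>\<^sub>B s a n)"
            proof (intro le_SUPI[of k] INF_greatest le_bimpI)
              fix n q2 assume n: "n \<in> {k..}" and q2: "q2 \<le> q1" "q2 \<le> lit \<top> (n \<in> {n. g n})"
              show "q2 \<le> s a n"
              proof (cases "g n")
                case True
                then have "q2 \<le> nat_name n \<in>\<^sub>B T"
                  using le_cellD[OF order_trans[OF order_trans[OF q2(1) q1(1)] q(2)], of n]
                  by (simp add: lit_def)
                then show ?thesis
                  by (rule le_bimpD[OF order_trans[OF q2(1) le_INFD[OF q1(2) n]]])
              next
                case False
                then show ?thesis
                  using q2(2) by (simp add: lit_def bot.extremum_unique)
              qed
            qed simp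
          qed
        qed
      next
        case False
        then obtain k where k: "\<not> g n" if "n \<ge> k" for n
          by (auto simp: finite_nat_set_iff_bounded not_le[symmetric])
        have "q \<le> bounded T"
          unfolding bounded_def
        proof (intro le_SUPI[of k] INF_greatest)
          fix n assume "n \<in> {k..}"
          then show "q \<le> - (nat_name n \<in>\<^sub>B T)"
            using k[of n] le_cellD[OF q(2), of n] by (simp add: lit_def)
        qed simp
        then show ?thesis
          by (rule le_uminusD[OF order_trans[OF q(1) T]])
      qed
    qed
  qed
  then show ?thesis
    by (simp add: top.extremum_unique)
qed

end

section \<open>A tree of sets of natural numbers\<close>

definition half :: "nat set \<Rightarrow> bool \<Rightarrow> nat set" where
  "half X i = range (\<lambda>n. enumerate X (2 * n + of_bool i))"

lemma half:
  assumes "infinite X"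
  shows "half X i \<subseteq> X" "infinite (half X i)" "half X True \<inter> half X False = {}"
proof -
  have inj: "enumerate X m = enumerate X n \<longleftrightarrow> m = n" for m n
    using strict_mono_enumerate[OF assms] by (simp add: strict_mono_eq)
  show "half X i \<subseteq> X"
    using enumerate_in_set[OF assms] by (auto simp: half_def)
  show "infinite (half X i)"
    unfolding half_def by (rule range_inj_infinite) (simp add: inj_def inj)
  show "half X True \<inter> half X False = {}"
    unfolding half_def by (auto simp: inj) presburger
qed

text \<open>
  The nodes of the tree at level \<open>a\<close> on the branch \<open>g\<close>: an infinite pseudo-intersection of the nodes below, chosen
  independently of \<open>g a\<close>, is cut into two halves, and \<open>g a\<close> selects one of them. Recursion is on \<open>a\<close> for fixed \<open>g\<close>.
\<close>

definition tree :: "'i rel \<Rightarrow> ('i \<Rightarrow> bool) \<Rightarrow> 'i \<Rightarrow> nat set" where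
  "tree r g = wfrec (r - Id)
     (\<lambda>T a. half (SOME X. infinite X \<and> (\<forall>b\<in>underS r a. finite (X - T b))) (g a))"

text \<open>
  The set that is halved at level \<open>a\<close>. It depends on \<open>g\<close> only below \<open>a\<close>.
\<close>

definition tree_limit :: "'i rel \<Rightarrow> ('i \<Rightarrow> bool) \<Rightarrow> 'i \<Rightarrow> nat set" where
  "tree_limit r g a = (SOME X. infinite X \<and> (\<forall>b\<in>underS r a. finite (X - tree r g b)))"

lemma tree_eq:
  assumes "Well_order r"
  shows "tree r g a = half (tree_limit r g a) (g a)"
proof -
  have "wf (r - Id)"
    using assms by (simp add: well_order_on_def)
  moreover have "(\<forall>b\<in>underS r a. finite (X - cut (tree r g) (r - Id) a b))
      \<longleftrightarrow> (\<forall>b\<in>underS r a. finite (X - tree r g b))" for X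
    by (auto simp: underS_def cut_apply)
  ultimately show ?thesis
    unfolding tree_limit_def by (subst tree_def, subst wfrec) (simp_all add: tree_def[symmetric])
qed

lemma tree_cong:
  assumes r: "Well_order r" and "a \<in> Field r" "\<And>b. b \<in> under r a \<Longrightarrow> g b = g' b"
  shows "tree r g a = tree r g' a"
proof -
  have "wf (r - Id)" "Refl r" "trans r"
    using r by (auto simp: well_order_on_def linear_order_on_def partial_order_on_def preorder_on_def)
  from this(1) assms(2,3) show ?thesis
  proof (induction a rule: wf_induct_rule)
    case (less a)
    have "tree r g b = tree r g' b" if "b \<in> underS r a" for b
      using that less.prems(2) \<open>trans r\<close>
      by (intro less.IH) (auto simp: underS_def under_def Field_def intro: transD)
    then have "tree_limit r g a = tree_limit r g' a"
      by (simp add: tree_limit_def)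
    moreover have "g a = g' a"
      using less.prems \<open>Refl r\<close> by (simp add: under_def refl_on_def)
    ultimately show ?case
      by (simp add: tree_eq[OF r])
  qed
qed

text \<open>
  This is what the construction of the tree needs in order to continue at every level: no sequence in the ground
  model whose length is an element of \<open>r\<close> is a tower.
\<close>

definition no_ground_tower :: "'i rel \<Rightarrow> bool" where
  "no_ground_tower r \<longleftrightarrow> (\<forall>a\<in>Field r. \<forall>S :: 'i \<Rightarrow> nat set.
     (\<forall>b\<in>underS r a. infinite (S b)) \<longrightarrow> (\<forall>c\<in>underS r a. \<forall>b\<in>underS r c. finite (S c - S b)) \<longrightarrow>
     (\<exists>X. infinite X \<and> (\<forall>b\<in>underS r a. finite (X - S b))))"

text \<open>
  The three properties are proved by a single induction: a pseudo-intersection at level \<open>a\<close> exists because the nodes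
  below are infinite and almost decreasing.
\<close>

lemma tree_levels:
  assumes r: "Well_order r"
    and lim: "no_ground_tower r"
    and a: "a \<in> Field r"
  shows infinite_tree: "infinite (tree r g a)"
    and tree_limit: "infinite (tree_limit r g a)"
    and tree_decreasing: "b \<in> underS r a \<Longrightarrow> finite (tree r g a - tree r g b)"
proof -
  have "wf (r - Id)"
    using r by (simp add: well_order_on_def)
  then have *: "infinite (tree r g a) \<and> infinite (tree_limit r g a) \<and>
    (\<forall>b\<in>underS r a. finite (tree r g a - tree r g b))" using a
  proof (induction a rule: wf_induct_rule)
    case (less a)
    have IH: "infinite (tree r g b) \<and> (\<forall>c\<in>underS r b. finite (tree r g b - tree r g c))"
      if "b \<in> underS r a" for b
      using less.IH[of b] that by (auto simp: underS_def Field_def)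
    have "\<exists>X. infinite X \<and> (\<forall>b\<in>underS r a. finite (X - tree r g b))"
      using lim[unfolded no_ground_tower_def, rule_format, of a "tree r g"] less.prems IH by blast
    then have X: "infinite (tree_limit r g a) \<and> (\<forall>b\<in>underS r a. finite (tree_limit r g a - tree r g b))"
      unfolding tree_limit_def
      by (rule someI_ex[of "\<lambda>X. infinite X \<and> (\<forall>b\<in>underS r a. finite (X - tree r g b))"])
    then have "finite (tree r g a - tree r g b)" if "b \<in> underS r a" for b
      using that half(1)[of "tree_limit r g a" "g a"]
      by - (rule finite_subset[of _ "tree_limit r g a - tree r g b"], auto simp: tree_eq[OF r, of g a])
    then show ?case
      using X half(2)[of "tree_limit r g a" "g a"] by (auto simp: tree_eq[OF r, of g a])
  qed
  then show "infinite (tree r g a)" "infinite (tree_limit r g a)"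
    "b \<in> underS r a \<Longrightarrow> finite (tree r g a - tree r g b)"
    by auto
qed

text \<open>
  At the least \<open>c\<close> where \<open>g\<close> and \<open>g'\<close> differ, the two branches take different halves of the same set; higher up, each
  branch is almost contained in the half that it took.
\<close>

lemma tree_almost_disjoint:
  assumes r: "Well_order r"
    and lim: "no_ground_tower r"
    and b: "b \<in> under r a" "g b \<noteq> g' b"
  shows "finite (tree r g a \<inter> tree r g' a)"
proof -
  have wf: "wf (r - Id)" and "Refl r" "trans r"
    using r by (auto simp: well_order_on_def linear_order_on_def partial_order_on_def preorder_on_def)
  define Q where "Q = {b \<in> under r a. g b \<noteq> g' b}"
  have "b \<in> Q"
    using b by (simp add: Q_def)
  then obtain c where "c \<in> Q" and min: "\<And>d. (d, c) \<in> r - Id \<Longrightarrow> d \<notin> Q"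
    by (rule wfE_min[OF wf]) blast
  then have c: "c \<in> under r a" "g c \<noteq> g' c"
    by (simp_all add: Q_def)
  have Field: "a \<in> Field r" "c \<in> Field r"
    using c(1) by (auto simp: under_def Field_def)
  have below: "g d = g' d" if "d \<in> underS r c" for d
    using min[of d] that c(1) \<open>trans r\<close> by (auto simp: Q_def underS_def under_def dest: transD)
  have "tree r g d = tree r g' d" if "d \<in> underS r c" for d
  proof (rule tree_cong[OF r])
    show "d \<in> Field r"
      using that by (auto simp: underS_def Field_def)
    fix e assume "e \<in> under r d"
    then have "e \<in> underS r c"
      using that r unfolding underS_def under_def well_order_on_def linear_order_on_def
        partial_order_on_def preorder_on_def by (auto dest: transD antisymD)
    then show "g e = g' e"
      by (rule below)
  qed
  then have "tree_limit r g c = tree_limit r g' c"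
    by (simp add: tree_limit_def)
  then have disj: "tree r g c \<inter> tree r g' c = {}"
    using half(3)[OF tree_limit[OF r lim Field(2)], of g] c(2)
    by (cases "g c"; cases "g' c") (auto simp: tree_eq[OF r])
  have fin: "finite (tree r g a - tree r g c)" for g
    using tree_decreasing[OF r lim Field(1), of c g] c(1) by (cases "c = a") (auto simp: underS_def under_def)
  show ?thesis
    by (rule finite_subset[OF _ finite_UnI[OF fin[of g] fin[of g']]]) (use disj in auto)
qed

section \<open>Distributivity along the well-order\<close>

context nat_index
begin

text \<open>
  A sequence of sets in the ground model is the special case of \<open>pseudo_intersection\<close> in which all values are \<open>\<top>\<close> or
  \<open>\<bottom>\<close>. As the algebra is not trivial, some \<open>X\<close> has a nonzero contribution to the supremum in its conclusion.
\<close>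

lemma ground_pseudo_intersection:
  fixes r :: "'i rel" and S :: "'i \<Rightarrow> nat set"
  assumes r: "Well_order r" "wo_rel.ofilter r A"
    and less: "less_tower_number r = (\<top> :: 'b::complete_ba)"
    and distr: "\<And>t :: nat \<Rightarrow> 'b. (\<Squnion>g. cell t g UNIV) = \<top>"
    and nontrivial: "(\<top> :: 'b) \<noteq> \<bottom>"
    and inf: "\<And>a. a \<in> A \<Longrightarrow> infinite (S a)"
    and dec: "\<And>a b. b \<in> A \<Longrightarrow> a \<in> underS r b \<Longrightarrow> finite (S b - S a)"
  shows "\<exists>X. infinite X \<and> (\<forall>a\<in>A. finite (X - S a))"
proof (rule ccontr)
  assume neg: "\<not> ?thesis"
  have "(\<Squnion>m. \<Sqinter>n\<in>{m..}. - lit \<top> (n \<in> S a)) = (\<bottom> :: 'b)" if a: "a \<in> A" for a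
  proof -
    have "(\<Sqinter>n\<in>{m..}. - lit \<top> (n \<in> S a)) \<le> (\<bottom> :: 'b)" for m
    proof -
      obtain n where "n \<ge> m" "n \<in> S a"
        using inf[OF a] unfolding infinite_nat_iff_unbounded_le by blast
      then show ?thesis
        by (intro INF_lower2[of n]) (auto simp: lit_def)
    qed
    then show ?thesis
      by (simp add: bot.extremum_unique)
  qed
  moreover have "almost_le (\<lambda>n. lit \<top> (n \<in> S b)) (\<lambda>n. lit \<top> (n \<in> S a)) = (\<top> :: 'b)"
    if "b \<in> A" "a \<in> underS r b" for a b
    unfolding almost_le_lit using dec[OF that] by (simp add: lit_def)
  ultimately have "(\<Squnion>X\<in>{X. infinite X}. \<Sqinter>a\<in>A. almost_le (\<lambda>n. lit \<top> (n \<in> X)) (\<lambda>n. lit \<top> (n \<in> S a))) = (\<top> :: 'b)"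
    by (rule pseudo_intersection[OF r less distr])
  moreover have "(\<Sqinter>a\<in>A. almost_le (\<lambda>n. lit \<top> (n \<in> X)) (\<lambda>n. lit \<top> (n \<in> S a))) \<le> (\<bottom> :: 'b)"
    if X: "infinite X" for X
  proof -
    obtain a where "a \<in> A" "infinite (X - S a)"
      using neg X by blast
    then show ?thesis
      unfolding almost_le_lit by (intro INF_lower2[of a]) (auto simp: lit_def)
  qed
  then have "(\<Squnion>X\<in>{X. infinite X}. \<Sqinter>a\<in>A. almost_le (\<lambda>n. lit \<top> (n \<in> X)) (\<lambda>n. lit \<top> (n \<in> S a))) \<le> (\<bottom> :: 'b)"
    by (intro SUP_least) auto
  ultimately show False
    using nontrivial by (simp add: bot.extremum_unique)
qed

text \<open>
  The main step. With \<open>f\<close> the function described by \<open>x\<close>, the value \<open>s a n\<close> is that of \<open>n \<in> T a f\<close>, where \<open>T\<close> is the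
  tree. By the induction hypothesis the cells at level \<open>a\<close> form a partition, and on the cell of \<open>g\<close> the
  set given by \<open>s a\<close> is \<open>T a g\<close>. So \<open>s\<close> is an almost decreasing sequence of infinite sets, and it has a
  pseudo-intersection \<open>X\<close> in the ground model. Then \<open>f a\<close> is forced to be \<open>h a\<close>, the common value \<open>g a\<close> of all \<open>g\<close>
  with \<open>T a g\<close> almost containing \<open>X\<close>.
\<close>

lemma SUP_cell_step:
  fixes r :: "'i rel" and x :: "'i \<Rightarrow> 'b::complete_ba"
  assumes r: "Well_order r" and A: "wo_rel.ofilter r A"
    and less: "less_tower_number r = (\<top> :: 'b)"
    and distr: "\<And>t :: nat \<Rightarrow> 'b. (\<Squnion>g. cell t g UNIV) = \<top>"
    and nontrivial: "(\<top> :: 'b) \<noteq> \<bottom>"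
    and IH: "\<And>a. a \<in> A \<Longrightarrow> (\<Squnion>g. cell x g (under r a)) = \<top>"
  shows "(\<Squnion>g. cell x g A) = \<top>"
proof -
  have lim: "no_ground_tower r"
    unfolding no_ground_tower_def
    using r by (intro ballI allI impI ground_pseudo_intersection[OF r _ less distr nontrivial])
      (auto simp: wo_rel.underS_ofilter wo_rel_def)
  have Field: "a \<in> Field r" if "a \<in> A" for a
    using A that r by (auto simp: wo_rel.ofilter_def wo_rel_def)
  have self: "a \<in> under r a" if "a \<in> A" for a
    using Field[OF that] r
    by (simp add: under_def well_order_on_def linear_order_on_def partial_order_on_def preorder_on_def refl_on_def)
  note tree_inf = infinite_tree[OF r lim Field]
    and tree_dec = tree_decreasing[OF r lim Field]
    and tree_disj = tree_almost_disjoint[OF r lim]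
  define s where "s a n = (\<Squnion>g\<in>{g. n \<in> tree r g a}. cell x g (under r a))" for a n
  \<comment> \<open>A cell that meets the cell of \<open>g\<close> agrees with \<open>g\<close> up to \<open>a\<close>, hence has the same node at level \<open>a\<close>.\<close>
  have s: "q \<le> s a n \<longleftrightarrow> q \<le> lit \<top> (n \<in> tree r g a)" if a: "a \<in> A" and q: "q \<le> cell x g (under r a)" for q a n g
  proof
    assume "q \<le> s a n"
    then show "q \<le> lit \<top> (n \<in> tree r g a)"
      unfolding s_def
    proof (rule le_SUPE)
      fix g' q' assume g': "g' \<in> {g. n \<in> tree r g a}" "q' \<le> q" "q' \<le> cell x g' (under r a)"
      show "q' \<le> lit \<top> (n \<in> tree r g a)"
      proof (cases "\<exists>b\<in>under r a. g b \<noteq> g' b")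
        case True
        then obtain b where b: "b \<in> under r a" "g b \<noteq> g' b"
          by blast
        have "q' \<le> lit (x b) (g b)" "q' \<le> lit (x b) (g' b)"
          using le_cellD[OF order_trans[OF g'(2) q] b(1)] le_cellD[OF g'(3) b(1)] by auto
        then have "q' \<le> \<bottom>"
          using b(2) le_uminusD[of q' "x b" \<bottom>] by (simp add: lit_def split: if_splits)
        then show ?thesis
          by (rule order_trans) simp
      next
        case False
        then have "tree r g a = tree r g' a"
          by (intro tree_cong r Field a) auto
        then show ?thesis
          using g'(1) by (simp add: lit_def)
      qed
    qed
  next
    assume "q \<le> lit \<top> (n \<in> tree r g a)"
    then show "q \<le> s a n"
      unfolding s_def
      using le_SUPI[of g "{g. n \<in> tree r g a}" q "\<lambda>g. cell x g (under r a)"] q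
      by (cases "n \<in> tree r g a") (simp_all add: lit_def bot.extremum_unique)
  qed
  have "(\<Squnion>m. \<Sqinter>n\<in>{m..}. - s a n) = \<bottom>" if a: "a \<in> A" for a
  proof -
    have "(\<Sqinter>n\<in>{m..}. - s a n) \<le> \<bottom>" for m
    proof -
      have "(\<Sqinter>n\<in>{m..}. - s a n) \<le> (\<Squnion>g. cell x g (under r a))"
        by (simp add: IH a)
      then show ?thesis
      proof (rule le_SUPE)
        fix g q assume q: "q \<le> (\<Sqinter>n\<in>{m..}. - s a n)" "q \<le> cell x g (under r a)"
        obtain n where n: "n \<ge> m" "n \<in> tree r g a"
          using tree_inf[OF a] unfolding infinite_nat_iff_unbounded_le by blast
        have "q \<le> - s a n"
          by (rule le_INFD[OF q(1)]) (simp add: n(1))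
        moreover have "q \<le> s a n"
          using s[OF a q(2), of n] n(2) by (simp add: lit_def)
        ultimately show "q \<le> \<bottom>"
          by (rule le_uminusD)
      qed
    qed
    then show ?thesis
      by (simp add: bot.extremum_unique)
  qed
  moreover have "almost_le (s b) (s a) = \<top>" if b: "b \<in> A" and ab: "a \<in> underS r b" for a b
  proof -
    have a: "a \<in> A" and sub: "under r a \<subseteq> under r b"
      using b ab A r unfolding wo_rel.ofilter_def[OF wo_rel.intro[OF r]]
      by (auto simp: underS_def under_def well_order_on_def linear_order_on_def partial_order_on_def
          preorder_on_def dest: transD)
    have "\<top> \<le> (\<Squnion>g. cell x g (under r b))"
      by (simp add: IH b)
    then have "\<top> \<le> almost_le (s b) (s a)"
    proof (rule le_SUPE)
      fix g q assume q: "q \<le> cell x g (under r b)"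
      then have q': "q \<le> cell x g (under r a)"
        using cell_mono[OF sub] by (rule order_trans)
      have "q \<le> almost_le (\<lambda>n. lit \<top> (n \<in> tree r g b)) (\<lambda>n. lit \<top> (n \<in> tree r g a))"
        unfolding almost_le_lit using tree_dec[OF b ab] by (simp add: lit_def)
      then show "q \<le> almost_le (s b) (s a)"
        unfolding almost_le_def
      proof (rule le_SUPE)
        fix m p assume p: "p \<le> q"
          "p \<le> (\<Sqinter>n\<in>{m..}. lit \<top> (n \<in> tree r g b) \<rightarrow>\<^sub>B lit \<top> (n \<in> tree r g a))"
        show "p \<le> (\<Squnion>m. \<Sqinter>n\<in>{m..}. s b n \<rightarrow>\<^sub>B s a n)"
        proof (intro le_SUPI[of m] INF_greatest le_bimpI)
          fix n p' assume n: "n \<in> {m..}" "p' \<le> p" "p' \<le> s b n"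
          have "p' \<le> q"
            using n(2) p(1) by simp
          then have "p' \<le> s b n \<longleftrightarrow> p' \<le> lit \<top> (n \<in> tree r g b)" "p' \<le> s a n \<longleftrightarrow> p' \<le> lit \<top> (n \<in> tree r g a)"
            using s[OF b, of p' g n] s[OF a, of p' g n] q q' by auto
          then show "p' \<le> s a n"
            using n(3) le_bimpD[OF order_trans[OF n(2) le_INFD[OF p(2) n(1)]]] by simp
        qed simp
      qed
    qed
    then show ?thesis
      by (simp add: top.extremum_unique)
  qed
  ultimately have "(\<Squnion>X\<in>{X. infinite X}. \<Sqinter>a\<in>A. almost_le (\<lambda>n. lit \<top> (n \<in> X)) (s a)) = \<top>"
    by (rule pseudo_intersection[OF r A less distr])
  then have "\<top> \<le> (\<Squnion>X\<in>{X. infinite X}. \<Sqinter>a\<in>A. almost_le (\<lambda>n. lit \<top> (n \<in> X)) (s a))"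
    by simp
  then have "\<top> \<le> (\<Squnion>g. cell x g A)"
  proof (rule le_SUPE)
    fix X p assume "X \<in> {X. infinite X}" and p: "p \<le> (\<Sqinter>a\<in>A. almost_le (\<lambda>n. lit \<top> (n \<in> X)) (s a))"
    then have X: "infinite X"
      by simp
    \<comment> \<open>All such \<open>g\<close> agree at \<open>a\<close>: otherwise the infinite set \<open>X\<close> is almost contained in two almost
      disjoint nodes.\<close>
    define h where "h a = (SOME g. finite (X - tree r g a)) a" for a
    have h: "g a = h a" if a: "a \<in> A" and g: "finite (X - tree r g a)" for g a
    proof (rule ccontr)
      let ?h = "SOME g. finite (X - tree r g a)"
      assume "g a \<noteq> h a"
      then have "finite (tree r g a \<inter> tree r ?h a)"
        using self[OF a] by (intro tree_disj) (auto simp: h_def)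
      moreover have "finite (X - tree r ?h a)"
        by (rule someI[of "\<lambda>g. finite (X - tree r g a)", OF g])
      ultimately have "finite ((tree r g a \<inter> tree r ?h a) \<union> (X - tree r g a) \<union> (X - tree r ?h a))"
        using g by simp
      then have "finite X"
        by (rule finite_subset[rotated]) auto
      with X show False
        by simp
    qed
    show "p \<le> (\<Squnion>g. cell x g A)"
    proof (rule le_SUPI[of h])
      show "p \<le> cell x h A"
        unfolding cell_def
      proof (rule INF_greatest)
        fix a assume a: "a \<in> A"
        have "p \<le> (\<Squnion>g. cell x g (under r a))"
          by (simp add: IH a)
        then show "p \<le> lit (x a) (h a)"
        proof (rule le_SUPE)
          fix g q assume q: "q \<le> p" "q \<le> cell x g (under r a)"
          have "q \<le> almost_le (\<lambda>n. lit \<top> (n \<in> X)) (\<lambda>n. lit \<top> (n \<in> tree r g a))"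
            by (rule le_almost_le_mono[OF order_trans[OF q(1) le_INFD[OF p a]]])
              (simp add: s[OF a order_trans[OF _ q(2)]])
          then have "q \<le> lit \<top> (finite (X - tree r g a))"
            by (simp add: almost_le_lit)
          then show "q \<le> lit (x a) (h a)"
            using le_cellD[OF q(2) self[OF a]] h[OF a, of g]
            by (cases "finite (X - tree r g a)") (auto simp: lit_def bot.extremum_unique)
        qed
      qed
    qed simp
  qed
  then show ?thesis
    by (simp add: top.extremum_unique)
qed

text \<open>
  Induction along \<open>r\<close>. The levels of the tree are the segments \<open>under r a\<close> that include \<open>a\<close>, so the step from all
  smaller elements leads to \<open>underS r a\<close>, and a single further splitting of the cells leads to \<open>under r a\<close>.
\<close>

lemma SUP_cell_Field:
  fixes r :: "'i rel" and x :: "'i \<Rightarrow> 'b::complete_ba"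
  assumes r: "Well_order r"
    and less: "less_tower_number r = (\<top> :: 'b)"
    and distr: "\<And>t :: nat \<Rightarrow> 'b. (\<Squnion>g. cell t g UNIV) = \<top>"
  shows "(\<Squnion>g. cell x g (Field r)) = \<top>"
proof (cases "(\<top> :: 'b) = \<bottom>")
  case True
  then show ?thesis
    using top_greatest[of "\<Squnion>g. cell x g (Field r)"] bot_least[of "\<Squnion>g. cell x g (Field r)"]
    by simp
next
  case False
  note step = SUP_cell_step[OF r _ less distr False]
  have "wf (r - Id)" and refl: "Refl r"
    using r by (auto simp: well_order_on_def linear_order_on_def partial_order_on_def preorder_on_def)
  from this(1) have "a \<in> Field r \<Longrightarrow> (\<Squnion>g. cell x g (under r a)) = \<top>" for a
  proof (induction a rule: wf_induct_rule)
    case (less a)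
    have "(\<Squnion>g. cell x g (underS r a)) = \<top>"
    proof (rule step)
      show "wo_rel.ofilter r (underS r a)"
        using r by (simp add: wo_rel.underS_ofilter wo_rel_def)
      show "(\<Squnion>g. cell x g (under r b)) = \<top>" if "b \<in> underS r a" for b
        using that less.IH[of b] by (auto simp: underS_def Field_def)
    qed
    moreover have "under r a = insert a (underS r a)"
      using less.prems refl by (auto simp: under_def underS_def refl_on_def)
    ultimately show ?case
      by (simp add: SUP_cell_insert)
  qed
  then show ?thesis
    by (rule step[rotated]) (simp_all add: wo_rel.Field_ofilter wo_rel_def r)
qed

end

theorem proposition4p3:
  fixes \<kappa> :: "'i rel"
  assumes "Cinfinite \<kappa>"
    and "distributive TYPE('b::complete_ba) (UNIV :: nat set) {..<2::nat}"
    and "forced (less_tower_number \<kappa> :: 'b)"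
  shows "distributive TYPE('b) (Field \<kappa>) {..<2::nat}"
proof -
  have "infinite (Field \<kappa>)" and r: "Well_order \<kappa>"
    using assms(1) by (simp_all add: cinfinite_def card_order_on_def)
  from infinite_countable_subset[OF this(1)] obtain e :: "nat \<Rightarrow> 'i" where "inj e"
    by blast
  then interpret nat_index e
    by unfold_locales
  show ?thesis
    unfolding distributive_iff_cells
  proof
    fix x :: "'i \<Rightarrow> 'b"
    show "(\<Squnion>g. cell x g (Field \<kappa>)) = \<top>"
      by (rule SUP_cell_Field[OF r])
        (use assms(2,3) in \<open>simp_all add: distributive_iff_cells forced_def\<close>)
  qed
qed

end
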